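(* Let $q$ be a complex number with $0<|q|<1$. (1) Define sequences $(P_m)_{m\ge -1}$, $(Q_m)_{m\ge -1}$ by $$P_m=(1+q+q^{2m-1})P_{m-1}-qP_{m-2}\quad(m\ge 2),\qquad P_{-1}=1,\ P_0=1,\ P_1=1+q,$$ $$Q_m=(1+q+q^{2m-1})Q_{m-1}-qQ_{m-2}\quad(m\ge 2),\qquad Q_{-1}=-q^{-1},\ Q_0=0,\ Q_1=1.$$ Then for every integer $m\ge 0$, $$\sum_{n=0}^{\infty}\frac{q^{n^2+2mn}}{(q;q)_{2n+1}}=\frac{q^{1-m}(q^4,q^6,q^{10};q^{10})_{\infty}(q^2,q^{18};q^{20})_{\infty}}{(q;q)_{\infty}}P_{m-1}-\frac{q^{1-m}(q^8,q^{12},q^{20};q^{20})_{\infty}(-q;q^2)_{\infty}}{(q^2;q^2)_{\infty}}Q_{m-1}.$$ (2) Define sequences $(A_m)_{m\ge 0}$, $(B_m)_{m\ge 0}$ by $$A_m=(1+q+q^{2m-2})A_{m-1}-qA_{m-2}\quad(m\ge 2),\qquad A_0=1,\ A_1=1,$$ $$B_m=(1+q+q^{2m-2})B_{m-1}-qB_{m-2}\quad(m\ge 2),\qquad B_0=0,\ B_1=q.$$ Then for every integer $m\ge 0$, $$\sum_{n=0}^{\infty}\frac{q^{n^2+2mn}}{(q;q)_{2n}}=\frac{(q^8,q^{12},q^{20};q^{20})_{\infty}(-q;q^2)_{\infty}}{(q^2;q^2)_{\infty}}A_m-\frac{(q^4,q^6,q^{10};q^{10})_{\infty}(q^2,q^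{18};q^{20})_{\infty}}{(q;q)_{\infty}}B_m.$$
   Context: For $|p|<1$, $(a;p)_\infty=\prod_{k=0}^{\infty}(1-ap^k)$ and, for an integer $n\ge 0$, $(a;p)_n=\prod_{k=0}^{n-1}(1-ap^k)$. Multiple $q$-shifted factorials are products: $(a_1,\dots,a_r;p)_\infty=(a_1;p)_\infty\cdots(a_r;p)_\infty$. *)

theory Defs
  imports "HOL-Analysis.Analysis"
begin

definition qpoch :: "complex \<Rightarrow> complex \<Rightarrow> nat \<Rightarrow> complex" where
  "qpoch a p n = (\<Prod>k<n. 1 - a * p ^ k)"

text \<open>
  Meaningful for \<open>norm p < 1\<close>, where the product converges for every \<open>a\<close> (in the
  sense of \<^const>\<open>convergent_prod\<close>, which allows finitely many zero factors).
\<close>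
definition qpoch_inf :: "complex \<Rightarrow> complex \<Rightarrow> complex" where
  "qpoch_inf a p = (\<Prod>k. 1 - a * p ^ k)"

text \<open>The multiple \<open>q\<close>-shifted factorial \<open>(a\<^sub>1, \<dots>, a\<^sub>r; p)\<^sub>\<infinity>\<close>.\<close>
definition qpochs_inf :: "complex list \<Rightarrow> complex \<Rightarrow> complex" where
  "qpochs_inf as p = (\<Prod>a\<leftarrow>as. qpoch_inf a p)"

end

theory Submission
  imports Defs "HOL-Library.Nat_Bijection"
begin

text \<open>
  Write \<open>S\<^sub>m\<close> and \<open>T\<^sub>m\<close> for the series with denominators \<open>(q;q)\<^sub>2\<^sub>n\<^sub>+\<^sub>1\<close> and \<open>(q;q)\<^sub>2\<^sub>n\<close>.
  Comparing terms gives \<open>S\<^sub>m - q S\<^sub>m\<^sub>+\<^sub>1 = T\<^sub>m\<close> and \<open>T\<^sub>m - T\<^sub>m\<^sub>+\<^sub>1 = q ^ (2m + 1) S\<^sub>m\<^sub>+\<^sub>1\<close>, which yield the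
  recurrences of the statement, so only \<open>S\<^sub>0\<close> and \<open>T\<^sub>0\<close> remain. These come from Bailey's method:
  in base \<open>p = q ^ 2\<close> the coefficients \<open>(-p;p)\<^sub>n / (p;p)\<^sub>2\<^sub>n\<close> and \<open>(-p;p)\<^sub>n / (p;p)\<^sub>2\<^sub>n\<^sub>+\<^sub>1\<close> are expanded as
  sums over \<open>r\<close> of \<open>(-1) ^ r p ^ (3r\<^sup>2 + r)\<close> times reciprocal factorials (an induction with Pascal's
  rule), the order of summation is exchanged, the inner sums are evaluated by a limiting case of the
  \<open>q\<close>-Gauss sum, and the resulting theta series \<open>\<Sum> (-1) ^ r q ^ (10r\<^sup>2 + 2r)\<close> and
  \<open>\<Sum> (-1) ^ r q ^ (10r\<^sup>2 + 6r)\<close> are products by Jacobi's triple product identity.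
\<close>

section \<open>Shifted factorials\<close>

lemma qpoch_0 [simp]: "qpoch a p 0 = 1"
  by (simp add: qpoch_def)

lemma qpoch_Suc: "qpoch a p (Suc n) = qpoch a p n * (1 - a * p ^ n)"
  by (simp add: qpoch_def)

lemma qpoch_add: "qpoch a p (m + n) = qpoch a p m * qpoch (a * p ^ m) p n"
  by (induction n) (simp_all add: qpoch_Suc power_add mult_ac)

lemma qpoch_Suc_left: "qpoch a p (Suc n) = (1 - a) * qpoch (a * p) p n"
  using qpoch_add[of a p 1 n] by (simp add: qpoch_Suc)

lemma qpoch_mult_minus: "qpoch a p n * qpoch (- a) p n = qpoch (a ^ 2) (p ^ 2) n"
  by (induction n) (simp_all add: qpoch_Suc algebra_simps power2_eq_square power_mult_distrib)

lemma qpoch_even: "qpoch a p (2 * n) = qpoch a (p ^ 2) n * qpoch (a * p) (p ^ 2) n"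
  by (induction n) (simp_all add: qpoch_Suc power_mult power2_eq_square power_mult_distrib mult_ac)

lemma qpoch_odd: "qpoch a p (2 * n + 1) = qpoch a (p ^ 2) (n + 1) * qpoch (a * p) (p ^ 2) n"
  using qpoch_even[of a p n] by (simp add: qpoch_Suc power_mult)

section \<open>Infinite products as limits of finite ones\<close>

lemma convergent_prod_qpoch:
  fixes a p :: complex
  assumes "norm p < 1"
  shows "convergent_prod (\<lambda>k. 1 - a * p ^ k)"
proof (rule abs_convergent_prod_imp_convergent_prod)
  have "summable (\<lambda>k. norm a * norm p ^ k)"
    using assms by (intro summable_mult summable_geometric) auto
  then show "abs_convergent_prod (\<lambda>k. 1 - a * p ^ k)"
    by (simp add: abs_convergent_prod_conv_summable norm_mult norm_power)
qed

lemma qpoch_LIMSEQ: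
  assumes "norm p < 1"
  shows "qpoch a p \<longlonglongrightarrow> qpoch_inf a p"
  using has_prod_imp_tendsto'[OF convergent_prod_has_prod[OF convergent_prod_qpoch[OF assms]]]
  unfolding qpoch_inf_def qpoch_def .

lemma qpoch_inf_nonzero:
  assumes "norm p < 1" "\<And>k. a * p ^ k \<noteq> 1"
  shows "qpoch_inf a p \<noteq> 0"
  unfolding qpoch_inf_def
  using prodinf_nonzero[OF convergent_prod_qpoch[OF assms(1)], of a] assms(2)
  by (metis eq_iff_diff_eq_0)

lemma qpoch_nonzero:
  assumes "\<And>k. a * p ^ k \<noteq> 1"
  shows "qpoch a p n \<noteq> 0"
  using assms by (simp add: qpoch_def)

lemma norm_less_one_imp_power_neq_one:
  fixes a p :: complex
  assumes "norm a < 1" "norm p \<le> 1"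
  shows "a * p ^ k \<noteq> 1"
proof
  assume "a * p ^ k = 1"
  then have "norm a * norm p ^ k = 1"
    by (metis norm_mult norm_one norm_power)
  moreover have "norm a * norm p ^ k \<le> norm a * 1"
    using assms by (intro mult_left_mono power_le_one) auto
  ultimately show False using assms by simp
qed

lemma qpoch_inf_shift:
  assumes "norm p < 1"
  shows "qpoch a p m * qpoch_inf (a * p ^ m) p = qpoch_inf a p"
proof (rule LIMSEQ_unique)
  show "(\<lambda>n. qpoch a p (m + n)) \<longlonglongrightarrow> qpoch a p m * qpoch_inf (a * p ^ m) p"
    unfolding qpoch_add by (intro tendsto_intros qpoch_LIMSEQ assms)
  show "(\<lambda>n. qpoch a p (m + n)) \<longlonglongrightarrow> qpoch_inf a p"
    using LIMSEQ_ignore_initial_segment[OF qpoch_LIMSEQ[OF assms], of a m] by (simp add: add.commute)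
qed

text \<open>The factors are sorted by the residue class of their exponent modulo \<open>m\<close>.
  The finite version groups the first \<open>m * n\<close> factors, so the limit is taken along that
  subsequence.\<close>

lemma qpoch_inf_dissect:
  assumes "norm p < 1" "0 < m"
  shows "qpoch_inf a p = (\<Prod>i<m. qpoch_inf (a * p ^ i) (p ^ m))"
proof (rule LIMSEQ_unique)
  have *: "qpoch a p (m * n) = (\<Prod>i<m. qpoch (a * p ^ i) (p ^ m) n)" for n
  proof (induction n)
    case (Suc n)
    have "m * Suc n = m * n + m" by simp
    then show ?case
      by (simp only: qpoch_add Suc)
         (simp add: qpoch_Suc prod.distrib qpoch_def[of _ p m] flip: power_mult, simp add: mult_ac)
  qed simp
  have "norm (p ^ m) < 1"
    using assms by (simp add: norm_power power_less_one_iff)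
  then show "(\<lambda>n. qpoch a p (m * n)) \<longlonglongrightarrow> (\<Prod>i<m. qpoch_inf (a * p ^ i) (p ^ m))"
    unfolding * by (intro tendsto_prod qpoch_LIMSEQ)
  show "(\<lambda>n. qpoch a p (m * n)) \<longlonglongrightarrow> qpoch_inf a p"
    using LIMSEQ_subseq_LIMSEQ[OF qpoch_LIMSEQ[OF assms(1), of a], of "\<lambda>n. m * n"] assms(2)
    by (simp add: o_def strict_mono_def)
qed

lemma qpoch_inf_mult_minus:
  assumes "norm p < 1"
  shows "qpoch_inf a p * qpoch_inf (- a) p = qpoch_inf (a ^ 2) (p ^ 2)"
proof (rule LIMSEQ_unique)
  show "(\<lambda>n. qpoch a p n * qpoch (- a) p n) \<longlonglongrightarrow> qpoch_inf a p * qpoch_inf (- a) p"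
    by (intro tendsto_intros qpoch_LIMSEQ assms)
  have "norm (p ^ 2) < 1"
    using assms by (simp add: norm_power power_less_one_iff)
  then show "(\<lambda>n. qpoch a p n * qpoch (- a) p n) \<longlonglongrightarrow> qpoch_inf (a ^ 2) (p ^ 2)"
    unfolding qpoch_mult_minus by (rule qpoch_LIMSEQ)
qed

section \<open>Uniform bounds and summable majorants\<close>

lemma qpoch_bounded:
  assumes "norm p < 1"
  obtains C where "0 < C" "\<And>n. norm (qpoch a p n) \<le> C"
  using convergent_imp_Bseq[OF convergentI[OF qpoch_LIMSEQ[OF assms, of a]]]
  unfolding Bseq_def by blast

lemma qpoch_inverse_bounded:
  assumes "norm p < 1" "\<And>k. a * p ^ k \<noteq> 1"
  obtains C where "0 < C" "\<And>n. norm (inverse (qpoch a p n)) \<le> C"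
  using convergent_imp_Bseq[OF convergentI[OF
      tendsto_inverse[OF qpoch_LIMSEQ[OF assms(1), of a] qpoch_inf_nonzero[OF assms]]]]
  unfolding Bseq_def by blast

text \<open>The ratio of consecutive terms has modulus \<open>\<bar>M\<bar> * r ^ k\<close>, which
  tends to 0 however large \<open>M\<close> is. This supplies the majorants for series whose
  exponents grow quadratically.\<close>

lemma summable_power_choose_two:
  fixes M r :: real
  assumes "0 \<le> r" "r < 1"
  shows "summable (\<lambda>k. M ^ k * r ^ (k choose 2))"
proof -
  have "(\<lambda>k. \<bar>M\<bar> * r ^ k) \<longlonglongrightarrow> \<bar>M\<bar> * 0"
    using assms by (intro tendsto_intros LIMSEQ_power_zero) auto
  then have "eventually (\<lambda>k. \<bar>M\<bar> * r ^ k < 1 / 2) sequentially"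
    by (rule order_tendstoD) simp
  then obtain N where N: "\<And>k. k \<ge> N \<Longrightarrow> \<bar>M\<bar> * r ^ k < 1 / 2"
    by (auto simp: eventually_sequentially)
  show ?thesis
  proof (rule summable_ratio_test[of "1 / 2" N])
    fix k assume "N \<le> k"
    have "norm (M ^ Suc k * r ^ (Suc k choose 2)) = (\<bar>M\<bar> * r ^ k) * norm (M ^ k * r ^ (k choose 2))"
      using assms by (simp add: numeral_2_eq_2 power_add abs_mult power_abs)
    also have "\<dots> \<le> 1 / 2 * norm (M ^ k * r ^ (k choose 2))"
      using N[OF \<open>N \<le> k\<close>] by (intro mult_right_mono) auto
    finally show "norm (M ^ Suc k * r ^ (Suc k choose 2)) \<le> 1 / 2 * norm (M ^ k * r ^ (k choose 2))" .
  qed simp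
qed

section \<open>The limiting case of the \<open>q\<close>-Gauss sum\<close>

text \<open>
  The limit \<open>b \<rightarrow> \<infinity>\<close> of the summand of \<open>\<^sub>2\<phi>\<^sub>1(c/x, b; c; p, x/b)\<close>. The factor \<open>(-1) ^ k x ^ k (c/x;p)\<^sub>k\<close>
  is written as a product that also makes sense for \<open>x = 0\<close>.
\<close>
definition gauss_term :: "complex \<Rightarrow> complex \<Rightarrow> complex \<Rightarrow> nat \<Rightarrow> complex" where
  "gauss_term p c x k = (\<Prod>i<k. c * p ^ i - x) * p ^ (k choose 2) / (qpoch p p k * qpoch c p k)"

text \<open>The constant is independent of both \<open>N\<close> and \<open>k\<close>, as dominated
  convergence for \<open>N\<close> tending to infinity requires. The factor
  \<open>norm p ^ N\<close>, raised to the power \<open>k\<close>, also forces every term with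
  \<open>k > 0\<close> to vanish in that limit.\<close>

lemma gauss_term_bound:
  assumes "norm p < 1" "\<And>k. c * p ^ k \<noteq> 1"
  obtains C where "0 < C"
    "\<And>N k. norm (gauss_term p (c * p ^ N) (x * p ^ N) k)
        \<le> C * (((norm c + norm x) * norm p ^ N) ^ k * norm p ^ (k choose 2))"
proof -
  have "p * p ^ k \<noteq> 1" for k
    using assms(1) by (intro norm_less_one_imp_power_neq_one) auto
  then obtain C1 where C1: "C1 > 0" "\<And>n. norm (inverse (qpoch p p n)) \<le> C1"
    using qpoch_inverse_bounded[OF assms(1)] by metis
  obtain C2 where C2: "C2 > 0" "\<And>n. norm (inverse (qpoch c p n)) \<le> C2"
    using qpoch_inverse_bounded[OF assms] by metis
  obtain C3 where C3: "C3 > 0" "\<And>n. norm (qpoch c p n) \<le> C3"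
    using qpoch_bounded[OF assms(1)] by metis
  show ?thesis
  proof (rule that[of "C1 * (C3 * C2)"])
    fix N k
    define M where "M = (norm c + norm x) * norm p ^ N"
    have "norm (c * p ^ N * p ^ i - x * p ^ N) \<le> M" for i
    proof -
      have "norm (c * p ^ N * p ^ i - x * p ^ N) \<le> norm c * norm p ^ N * norm p ^ i + norm x * norm p ^ N"
        using norm_triangle_ineq4[of "c * p ^ N * p ^ i" "x * p ^ N"] by (simp add: norm_mult norm_power)
      also have "\<dots> \<le> norm c * norm p ^ N * 1 + norm x * norm p ^ N"
        using assms(1) by (intro add_mono mult_left_mono power_le_one) auto
      finally show ?thesis by (simp add: M_def algebra_simps)
    qed
    then have 1: "norm (\<Prod>i<k. c * p ^ N * p ^ i - x * p ^ N) \<le> M ^ k"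
      using prod_mono[of "{..<k}" "\<lambda>i. norm (c * p ^ N * p ^ i - x * p ^ N)" "\<lambda>_. M"]
      by (simp add: prod_norm)
    have "qpoch c p N \<noteq> 0"
      using assms(2) by (rule qpoch_nonzero)
    \<comment> \<open>The shifted parameter is traded for factorials with the fixed parameter
      \<open>c\<close>, so that the bounds \<open>C2\<close> and \<open>C3\<close> do not depend on
      \<open>N\<close>.\<close>
    then have "inverse (qpoch (c * p ^ N) p k) = qpoch c p N * inverse (qpoch c p (N + k))"
      by (simp add: qpoch_add divide_simps)
    then have 2: "norm (inverse (qpoch (c * p ^ N) p k)) \<le> C3 * C2"
      using C2 C3 by (simp only: norm_mult) (intro mult_mono, auto intro: less_imp_le)
    have "norm (gauss_term p (c * p ^ N) (x * p ^ N) k) =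
        (norm (inverse (qpoch p p k)) * norm (inverse (qpoch (c * p ^ N) p k))) *
        (norm (\<Prod>i<k. c * p ^ N * p ^ i - x * p ^ N) * norm p ^ (k choose 2))"
      by (simp add: gauss_term_def norm_mult norm_divide norm_power norm_inverse divide_simps)
    also have "\<dots> \<le> (C1 * (C3 * C2)) * (M ^ k * norm p ^ (k choose 2))"
      using C1 C2 C3 1 2 by (intro mult_mono) (auto intro!: less_imp_le mult_nonneg_nonneg order.trans[OF norm_ge_zero 1])
    finally show "norm (gauss_term p (c * p ^ N) (x * p ^ N) k)
        \<le> C1 * (C3 * C2) * (((norm c + norm x) * norm p ^ N) ^ k * norm p ^ (k choose 2))"
      by (simp only: M_def)
  qed (use C1 C2 C3 in simp)
qed

lemma tannery_sequentially:
  fixes a :: "nat \<Rightarrow> nat \<Rightarrow> complex"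
  assumes "\<And>k. (\<lambda>n. a n k) \<longlonglongrightarrow> b k" "\<And>n k. norm (a n k) \<le> M k" "summable M"
  shows "(\<lambda>n. suminf (a n)) \<longlonglongrightarrow> suminf b"
proof -
  have "eventually (\<lambda>(k, n). norm (a n k) \<le> M k) (at_top \<times>\<^sub>F sequentially)"
    using assms(2) by (simp add: case_prod_unfold)
  then show ?thesis
    using tannerys_theorem[of "\<lambda>k n. a n k" b sequentially M] assms(1,3) by simp
qed

lemma summable_gauss_term:
  assumes "norm p < 1" "\<And>k. c * p ^ k \<noteq> 1"
  shows "summable (\<lambda>k. norm (gauss_term p c x k))"
proof -
  obtain C where C: "\<And>N k. norm (gauss_term p (c * p ^ N) (x * p ^ N) k)
        \<le> C * (((norm c + norm x) * norm p ^ N) ^ k * norm p ^ (k choose 2))"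
    using gauss_term_bound[OF assms] by metis
  have "summable (\<lambda>k. C * ((norm c + norm x) ^ k * norm p ^ (k choose 2)))"
    using assms(1) by (intro summable_mult summable_power_choose_two) auto
  then show ?thesis
    by (rule summable_comparison_test_ev[rotated]) (use C[of 0] in simp)
qed

text \<open>A contiguous relation proved by telescoping. The difference of the two summands is
  \<open>G k - G (Suc k)\<close>, where \<open>G\<close> is the summand times
  \<open>(1 - c) * (1 - p ^ k)\<close>. Since \<open>G 0 = 0\<close> and \<open>G\<close> tends to
  0, the differences sum to 0.\<close>

lemma suminf_gauss_term_shift:
  assumes p: "norm p < 1" and c: "\<And>k. c * p ^ k \<noteq> 1"
  shows "(1 - c) * suminf (gauss_term p c x) = (1 - x) * suminf (gauss_term p (c * p) (x * p))"
proof -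
  define G where "G k = (1 - c) * (1 - p ^ k) * gauss_term p c x k" for k
  have pk: "p * p ^ k \<noteq> 1" for k
    using p by (intro norm_less_one_imp_power_neq_one) auto
  have cp: "c * p * p ^ k \<noteq> 1" for k
    using c[of "Suc k"] by (simp add: mult_ac)
  have G: "(1 - c) * gauss_term p c x k - (1 - x) * gauss_term p (c * p) (x * p) k = G k - G (Suc k)" for k
  proof -
    \<comment> \<open>Naming the products and powers turns the termwise claim into an identity of
      rational functions in these atoms.\<close>
    define a where "a = (\<Prod>i<k. c * p ^ i - x)"
    define b where "b = qpoch c p k"
    define d where "d = qpoch p p k"
    define w where "w = p ^ (k choose 2)"
    define y where "y = p ^ k"
    have nz: "b \<noteq> 0" "d \<noteq> 0" "1 - c \<noteq> 0" "1 - c * y \<noteq> 0" "1 - p * y \<noteq> 0"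
      using qpoch_nonzero[OF c] qpoch_nonzero[OF pk] c[of 0] c[of k] pk[of k]
      by (auto simp: b_def d_def y_def)
    have 1: "(1 - c) * qpoch (c * p) p k = b * (1 - c * y)"
      using qpoch_Suc_left[of c p k] qpoch_Suc[of c p k] by (simp add: b_def y_def)
    then have 2: "qpoch (c * p) p k = b * (1 - c * y) / (1 - c)"
      using nz by (simp add: field_simps)
    have "(\<Prod>i<k. c * p * p ^ i - x * p) = (\<Prod>i<k. p * (c * p ^ i - x))"
      by (intro prod.cong) (auto simp: algebra_simps)
    then have 3: "(\<Prod>i<k. c * p * p ^ i - x * p) = y * a"
      by (simp add: prod.distrib a_def y_def)
    have t: "gauss_term p c x k = a * w / (d * b)"
      by (simp add: gauss_term_def a_def b_def d_def w_def)
    have t': "gauss_term p (c * p) (x * p) k = y * a * w * (1 - c) / (d * (b * (1 - c * y)))"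
      unfolding gauss_term_def 2 3 using nz by (simp add: d_def w_def)
    have ts: "gauss_term p c x (Suc k) = a * (c * y - x) * (w * y) / (d * (1 - p * y) * (b * (1 - c * y)))"
      by (simp add: gauss_term_def a_def b_def d_def w_def y_def qpoch_Suc power_add numeral_2_eq_2 mult_ac)
    have "G (Suc k) = (1 - c) * (a * (c * y - x) * (w * y)) / (d * (b * (1 - c * y)))"
      unfolding G_def ts using nz by (simp add: y_def)
    moreover have "(1 - c) * (a * w / (d * b)) = (1 - c) * (a * w * (1 - c * y)) / (d * (b * (1 - c * y)))"
      using nz by simp
    ultimately show ?thesis
      unfolding G_def[of k] t t' y_def[symmetric] using nz
      by (simp add: divide_simps) (simp add: algebra_simps)
  qed
  have s: "summable (gauss_term p c x)" "summable (gauss_term p (c * p) (x * p))"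
    using summable_norm_cancel[OF summable_gauss_term[OF p c]]
      summable_norm_cancel[OF summable_gauss_term[OF p cp]] by auto
  have "G \<longlonglongrightarrow> (1 - c) * (1 - 0) * 0"
    unfolding G_def using p by (intro tendsto_intros LIMSEQ_power_zero summable_LIMSEQ_zero s) auto
  then have "(\<lambda>k. G k - G (Suc k)) sums (G 0 - 0)"
    by (intro telescope_sums') simp
  then have "(\<lambda>k. G k - G (Suc k)) sums 0"
    by (simp add: G_def)
  moreover have "(\<lambda>k. G k - G (Suc k)) sums ((1 - c) * suminf (gauss_term p c x)
      - (1 - x) * suminf (gauss_term p (c * p) (x * p)))"
    unfolding G[symmetric] by (intro sums_diff sums_mult summable_sums s)
  ultimately show ?thesis
    by (metis eq_iff_diff_eq_0 sums_unique2)
qed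

text \<open>Iterating the contiguous relation \<open>N\<close> times moves the parameters to
  \<open>c * p ^ N\<close> and \<open>x * p ^ N\<close>, which tend to 0. By Tannery's theorem the
  shifted series tends to its \<open>k = 0\<close> term, namely 1, and the accumulated factors
  become the two infinite products.\<close>

lemma gauss_term_sums:
  assumes p: "norm p < 1" and c: "\<And>k. c * p ^ k \<noteq> 1"
  shows "gauss_term p c x sums (qpoch_inf x p / qpoch_inf c p)"
proof -
  define f where "f N = suminf (gauss_term p (c * p ^ N) (x * p ^ N))" for N
  have cN: "c * p ^ N * p ^ k \<noteq> 1" for N k
    using c[of "N + k"] by (simp add: power_add mult_ac)
  have f: "qpoch c p N * f 0 = qpoch x p N * f N" for N
  proof (induction N)
    case (Suc N)
    have "(1 - c * p ^ N) * f N = (1 - x * p ^ N) * f (Suc N)"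
      using suminf_gauss_term_shift[OF p cN, of N "x * p ^ N"] by (simp add: f_def mult_ac)
    then show ?case
      using Suc by (simp add: qpoch_Suc) (metis mult.assoc mult.commute)
  qed (simp add: f_def)
  obtain C where C: "C > 0" "\<And>N k. norm (gauss_term p (c * p ^ N) (x * p ^ N) k)
        \<le> C * (((norm c + norm x) * norm p ^ N) ^ k * norm p ^ (k choose 2))"
    using gauss_term_bound[OF p c] by metis
  have bound: "norm (gauss_term p (c * p ^ N) (x * p ^ N) k)
      \<le> C * ((norm c + norm x) ^ k * norm p ^ (k choose 2))" for N k
  proof -
    have "((norm c + norm x) * norm p ^ N) ^ k \<le> ((norm c + norm x) * 1) ^ k"
      using p by (intro power_mono mult_left_mono power_le_one) auto
    then have "C * (((norm c + norm x) * norm p ^ N) ^ k * norm p ^ (k choose 2))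
        \<le> C * ((norm c + norm x) ^ k * norm p ^ (k choose 2))"
      using C(1) by (intro mult_left_mono mult_right_mono) auto
    then show ?thesis using C(2)[of N k] by linarith
  qed
  have lim: "(\<lambda>N. gauss_term p (c * p ^ N) (x * p ^ N) k) \<longlonglongrightarrow> (if k = 0 then 1 else 0)" for k
  proof (cases "k = 0")
    case True
    then show ?thesis by (simp add: gauss_term_def numeral_2_eq_2)
  next
    case False
    have "(\<lambda>N. C * (((norm c + norm x) * norm p ^ N) ^ k * norm p ^ (k choose 2)))
        \<longlonglongrightarrow> C * (((norm c + norm x) * 0) ^ k * norm p ^ (k choose 2))"
      using p by (intro tendsto_intros LIMSEQ_power_zero) auto
    also have "C * (((norm c + norm x) * 0) ^ k * norm p ^ (k choose 2)) = 0"
      using False by simp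
    finally have "(\<lambda>N. gauss_term p (c * p ^ N) (x * p ^ N) k) \<longlonglongrightarrow> 0"
      by (rule Lim_null_comparison[OF always_eventually[OF allI[OF C(2)]]])
    then show ?thesis using False by simp
  qed
  have "summable (\<lambda>k. C * ((norm c + norm x) ^ k * norm p ^ (k choose 2)))"
    using p by (intro summable_mult summable_power_choose_two) auto
  from tannery_sequentially[OF lim bound this]
  have "f \<longlonglongrightarrow> (\<Sum>k. if k = 0 then 1 else 0)"
    unfolding f_def[abs_def] .
  also have "(\<Sum>k::nat. if k = 0 then 1 else 0 :: complex) = 1"
    using sums_single[of 0 "\<lambda>_. 1::complex"] by (simp add: sums_iff)
  finally have "(\<lambda>N. qpoch x p N * f N) \<longlonglongrightarrow> qpoch_inf x p * 1"
    by (intro tendsto_intros qpoch_LIMSEQ p)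
  moreover have "(\<lambda>N. qpoch c p N * f 0) \<longlonglongrightarrow> qpoch_inf c p * f 0"
    by (intro tendsto_intros qpoch_LIMSEQ p)
  ultimately have "qpoch_inf c p * f 0 = qpoch_inf x p"
    using f LIMSEQ_unique by simp
  then have "f 0 = qpoch_inf x p / qpoch_inf c p"
    using qpoch_inf_nonzero[OF p c] by (simp add: field_simps)
  then show ?thesis
    using summable_sums[OF summable_norm_cancel[OF summable_gauss_term[OF p c, of x]]]
    by (simp add: f_def)
qed

section \<open>Reciprocal \<open>q\<close>-factorials and the finite identities\<close>

text \<open>This is the convention that 1/(p;p)_k vanishes for negative k. With it, the finite sums
  below can run over all integers, where they may be reflected and shifted without boundary
  terms.\<close>

definition rfact :: "complex \<Rightarrow> int \<Rightarrow> complex" where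
  "rfact p k = (if k < 0 then 0 else inverse (qpoch p p (nat k)))"

lemma rfact_neg [simp]: "k < 0 \<Longrightarrow> rfact p k = 0"
  by (simp add: rfact_def)

lemma rfact_int [simp]: "rfact p (int n) = inverse (qpoch p p n)"
  by (simp add: rfact_def)

lemma rfact_0 [simp]: "rfact p 0 = 1"
  by (simp add: rfact_def)

lemma self_mult_power_neq_one:
  fixes p :: complex
  assumes "norm p < 1"
  shows "p * p ^ k \<noteq> 1"
  using assms by (intro norm_less_one_imp_power_neq_one) auto

text \<open>At \<open>k = 0\<close> the factor \<open>1 - p powi k\<close> is 0, in agreement with
  the value 0 of \<open>rfact\<close> at -1; this makes the recurrence valid on all
  integers.\<close>

lemma rfact_rec:
  assumes "norm p < 1"
  shows "(1 - p powi k) * rfact p k = rfact p (k - 1)"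
proof (cases "k \<le> 0")
  case False
  then obtain n where k: "k = int (Suc n)"
    by (metis not_le zero_less_imp_eq_int gr0_conv_Suc of_nat_0_less_iff)
  have "nat (int (Suc n)) = Suc n" "nat (int (Suc n) - 1) = n" by auto
  moreover have "p powi int (Suc n) = p * p ^ n" by (simp only: power_int_of_nat power_Suc)
  ultimately show ?thesis
    using self_mult_power_neq_one[OF assms, of n] qpoch_nonzero[OF self_mult_power_neq_one[OF assms], of n]
    unfolding k rfact_def by (simp add: qpoch_Suc)
qed (auto simp: rfact_def)

text \<open>The q-Pascal rule, from the splitting 1 - p^(a+b) = (1 - p^a) + p^a (1 - p^b) and one
  application of the recurrence to each part.\<close>

lemma rfact_pascal:
  assumes "norm p < 1" "p \<noteq> 0"
  shows "(1 - p powi (a + b)) * (rfact p a * rfact p b)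
      = rfact p (a - 1) * rfact p b + p powi a * (rfact p a * rfact p (b - 1))"
  unfolding rfact_rec[OF assms(1), symmetric] using assms(2)
  by (simp add: power_int_add algebra_simps)

text \<open>This rule and the next one alternate between the kernels with indices (n - j, n + j) and
  (n - j, n + 1 + j): the odd total leads from the first to the second, the even total back to the
  first with n + 1. Together they drive the inductions in \<open>slater_pair\<close> and
  \<open>finite_triple_product\<close>.\<close>

lemma rfact_pascal_odd:
  assumes "norm p < 1" "p \<noteq> 0"
  shows "(1 - p ^ (2 * n + 1)) * (rfact p (int n - j) * rfact p (int n + 1 + j))
      = rfact p (int n - j) * rfact p (int n + j)
        + p powi (int n + 1 + j) * (rfact p (int n + 1 + j) * rfact p (int n - j - 1))"
proof -
  have "int n + 1 + j + (int n - j) = int (2 * n + 1)" "int n + 1 + j - 1 = int n + j"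
    by simp_all
  then show ?thesis
    using rfact_pascal[OF assms, of "int n + 1 + j" "int n - j"]
    by (simp only: power_int_of_nat) (simp only: mult_ac)
qed

lemma rfact_pascal_even:
  assumes "norm p < 1" "p \<noteq> 0"
  shows "(1 - p ^ (2 * n + 2)) * (rfact p (int (Suc n) - j) * rfact p (int (Suc n) + j))
      = rfact p (int n - j) * rfact p (int n + 1 + j)
        + p powi (int n + 1 - j) * (rfact p (int n + 1 - j) * rfact p (int n + j))"
proof -
  have "int n + 1 - j + (int n + 1 + j) = int (2 * n + 2)" "int n + 1 - j - 1 = int n - j"
    "int n + 1 + j - 1 = int n + j" "int (Suc n) = int n + 1"
    by simp_all
  then show ?thesis
    using rfact_pascal[OF assms, of "int n + 1 - j" "int n + 1 + j"]
    by (simp only: power_int_of_nat)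
qed

lemma rfact_bounded:
  assumes "norm p < 1"
  obtains C where "0 < C" "\<And>k. norm (rfact p k) \<le> C"
proof -
  obtain C where "C > 0" "\<And>n. norm (inverse (qpoch p p n)) \<le> C"
    using qpoch_inverse_bounded[OF assms self_mult_power_neq_one[OF assms]] by metis
  then show ?thesis by (intro that[of C]) (auto simp: rfact_def)
qed

lemma rfact_LIMSEQ:
  assumes "norm p < 1"
  shows "(\<lambda>n. rfact p (int n + j)) \<longlonglongrightarrow> inverse (qpoch_inf p p)"
proof -
  have "filterlim (\<lambda>n. nat (int n + j)) sequentially sequentially"
    unfolding filterlim_at_top eventually_sequentially
  proof (intro allI exI impI)
    fix Z n assume "nat \<bar>j\<bar> + Z \<le> n"
    then show "Z \<le> nat (int n + j)" by linarith
  qed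
  then have "(\<lambda>n. inverse (qpoch p p (nat (int n + j)))) \<longlonglongrightarrow> inverse (qpoch_inf p p)"
    using assms by (intro tendsto_inverse filterlim_compose[OF qpoch_LIMSEQ] qpoch_inf_nonzero self_mult_power_neq_one)
  moreover have "eventually (\<lambda>n. inverse (qpoch p p (nat (int n + j))) = rfact p (int n + j)) sequentially"
    unfolding eventually_sequentially by (intro exI[of _ "nat \<bar>j\<bar>"]) (auto simp: rfact_def)
  ultimately show ?thesis
    by (rule Lim_transform_eventually)
qed

section \<open>Sums indexed by all integers\<close>

lemma summable_on_rfact_mult:
  assumes "\<And>r::int. \<bar>r\<bar> > M \<Longrightarrow> a r < 0 \<or> b r < 0"
  shows "(\<lambda>r. f r * (rfact p (a r) * rfact p (b r))) summable_on UNIV"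
proof (rule finite_nonzero_values_imp_summable_on)
  have "{r \<in> UNIV. f r * (rfact p (a r) * rfact p (b r)) \<noteq> 0} \<subseteq> {-\<bar>M\<bar>..\<bar>M\<bar>}"
  proof
    fix r assume "r \<in> {r \<in> UNIV. f r * (rfact p (a r) * rfact p (b r)) \<noteq> 0}"
    then have "\<not> (a r < 0 \<or> b r < 0)" by auto
    then have "\<bar>r\<bar> \<le> M" using assms[of r] by linarith
    then show "r \<in> {-\<bar>M\<bar>..\<bar>M\<bar>}" by auto
  qed
  then show "finite {r \<in> UNIV. f r * (rfact p (a r) * rfact p (b r)) \<noteq> 0}"
    by (rule finite_subset) simp
qed

lemma has_sum_cancel_factor:
  fixes f g :: "'a \<Rightarrow> complex"
  assumes "(f has_sum s) A" "\<And>x. f x = c * g x" "c \<noteq> 0"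
  shows "(g has_sum (s / c)) A"
  using assms(1,3) unfolding ext[of f "\<lambda>x. c * g x", OF assms(2)]
  by (simp add: has_sum_cmult_right_iff)

lemma has_sum_int_reflect:
  fixes f g :: "int \<Rightarrow> complex"
  assumes "(f has_sum s) UNIV" "\<And>r. f (c - r) = g r"
  shows "(g has_sum s) UNIV"
  using assms by (subst has_sum_reindex_bij_witness[of UNIV "\<lambda>r. c - r" "\<lambda>r. c - r" UNIV f]) auto

lemma has_sum_int_shift:
  fixes f g :: "int \<Rightarrow> complex"
  assumes "(f has_sum s) UNIV" "\<And>r. f (r + c) = g r"
  shows "(g has_sum s) UNIV"
  using assms by (subst has_sum_reindex_bij_witness[of UNIV "\<lambda>r. r - c" "\<lambda>r. r + c" UNIV f]) auto

text \<open>Reflecting the index shows that the sum equals its own negative.\<close>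

lemma has_sum_int_antisymmetric:
  fixes f :: "int \<Rightarrow> complex"
  assumes "f summable_on UNIV" "\<And>r. f (c - r) = - f r"
  shows "(f has_sum 0) UNIV"
proof -
  obtain s where s: "(f has_sum s) UNIV"
    using assms(1) by (auto simp: summable_on_def)
  have "((\<lambda>r. - f r) has_sum s) UNIV"
    by (rule has_sum_int_reflect[OF s assms(2)])
  then have "(f has_sum - s) UNIV"
    using has_sum_uminusI by fastforce
  then have "s = - s"
    using s has_sum_unique by blast
  then show ?thesis using s by simp
qed

text \<open>
  The \<open>\<alpha>\<close> of two Bailey pairs at once, relative to \<open>a = 1\<close> and to \<open>a = p\<close>: letting \<open>r\<close> run over all
  integers replaces the usual case distinction on the parity of the index.
\<close>
definition slater_coeff :: "complex \<Rightarrow> int \<Rightarrow> complex" where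
  "slater_coeff p r = (-1) powi r * p powi (3 * r ^ 2 + r)"

lemma minus_one_powi_minus: "(-1 :: complex) powi (c - r) = (-1) powi c * (-1) powi r"
  by (simp add: power_int_diff power_int_minus_left)

text \<open>Both sums are obtained by one alternating induction: \<open>ED\<close> passes from the
  sum \<open>E\<close> to the sum \<open>D\<close> at the same \<open>n\<close>, and
  \<open>DE\<close> passes from \<open>D\<close> at \<open>n\<close> to \<open>E\<close> at
  \<open>Suc n\<close>. Each half step multiplies out one further factor of the denominator by
  Pascal's rule.\<close>

lemma slater_pair:
  assumes p: "norm p < 1" "p \<noteq> 0"
  shows "((\<lambda>r. slater_coeff p r * (rfact p (int n - 2 * r) * rfact p (int n + 2 * r)))
            has_sum (qpoch (- p) p n / qpoch p p (2 * n))) UNIV"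
    and "((\<lambda>r. slater_coeff p r * (rfact p (int n - 2 * r) * rfact p (int n + 1 + 2 * r)))
            has_sum (qpoch (- p) p n / qpoch p p (2 * n + 1))) UNIV"
proof -
  define E where "E n r = slater_coeff p r * (rfact p (int n - 2 * r) * rfact p (int n + 2 * r))" for n r
  define D where "D n r = slater_coeff p r * (rfact p (int n - 2 * r) * rfact p (int n + 1 + 2 * r))" for n r
  have nz: "1 - p ^ Suc k \<noteq> 0" "qpoch p p k \<noteq> 0" for k
    using self_mult_power_neq_one[OF p(1), of k] qpoch_nonzero[OF self_mult_power_neq_one[OF p(1)]] by auto
  have ED: "(D n has_sum (s / (1 - p ^ (2 * n + 1)))) UNIV" if "(E n has_sum s) UNIV" for n s
  proof -
    define h where "h r = (slater_coeff p r * p powi (int n + 1 + 2 * r)) *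
      (rfact p (int n + 1 + 2 * r) * rfact p (int n - 2 * r - 1))" for r
    \<comment> \<open>Half of the Pascal expansion cancels under \<open>r \<mapsto> -1 - r\<close>.\<close>
    have "h (-1 - r) = - h r" for r
      unfolding h_def slater_coeff_def minus_one_powi_minus using p(2)
      by (simp add: algebra_simps power2_eq_square flip: power_int_add)
    moreover have "h summable_on UNIV"
      unfolding h_def by (rule summable_on_rfact_mult[where M = "int n + 1"]) auto
    ultimately have "(h has_sum 0) UNIV"
      by (rule has_sum_int_antisymmetric[rotated])
    then have "((\<lambda>r. E n r + h r) has_sum (s + 0)) UNIV"
      by (intro has_sum_add that)
    moreover have "E n r + h r = (1 - p ^ (2 * n + 1)) * D n r" for r
    proof -
      have "E n r + h r = slater_coeff p r * (rfact p (int n - 2 * r) * rfact p (int n + 2 * r) +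
          p powi (int n + 1 + 2 * r) * (rfact p (int n + 1 + 2 * r) * rfact p (int n - 2 * r - 1)))"
        by (simp only: E_def h_def distrib_left mult_ac)
      then show ?thesis
        by (simp only: rfact_pascal_odd[OF p, symmetric] D_def) (simp only: mult_ac)
    qed
    ultimately have "(D n has_sum ((s + 0) / (1 - p ^ (2 * n + 1)))) UNIV"
      by (rule has_sum_cancel_factor) (use nz(1)[of "2 * n"] in simp)
    then show ?thesis by simp
  qed
  have DE: "(E (Suc n) has_sum ((1 + p ^ Suc n) * s / (1 - p ^ (2 * n + 2)))) UNIV" if "(D n has_sum s) UNIV" for n s
  proof -
    define h where "h r = slater_coeff p r * p powi (int n + 1 - 2 * r) *
      (rfact p (int n + 1 - 2 * r) * rfact p (int n + 2 * r))" for r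
    \<comment> \<open>Here the second half of the Pascal expansion does not cancel: under the
      reflection of \<open>r\<close> to \<open>- r\<close> it is \<open>p ^ Suc n\<close> times the
      first half. This supplies the new factor \<open>1 + p ^ Suc n\<close> of
      \<open>qpoch (- p) p (Suc n)\<close>.\<close>
    have "p ^ Suc n * D n (0 - r) = h r" for r
    proof -
      have "p ^ Suc n * p powi (3 * (0 - r) ^ 2 + (0 - r)) = p powi (3 * r ^ 2 + r) * p powi (int n + 1 - 2 * r)"
        using p(2) by (simp only: power_int_of_nat[symmetric] power_int_add[symmetric] simp_thms) (simp add: algebra_simps)
      then have coeff: "p ^ Suc n * slater_coeff p (0 - r) = slater_coeff p r * p powi (int n + 1 - 2 * r)"
        unfolding slater_coeff_def minus_one_powi_minus by (simp add: mult.assoc)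
      have "int n - 2 * (0 - r) = int n + 2 * r" "int n + 1 + 2 * (0 - r) = int n + 1 - 2 * r"
        by simp_all
      then have "p ^ Suc n * D n (0 - r) = p ^ Suc n * slater_coeff p (0 - r) *
          (rfact p (int n + 1 - 2 * r) * rfact p (int n + 2 * r))"
        by (simp only: D_def mult_ac)
      then show ?thesis
        unfolding coeff h_def .
    qed
    moreover have "((\<lambda>r. p ^ Suc n * D n r) has_sum (p ^ Suc n * s)) UNIV"
      by (intro has_sum_cmult_right that)
    ultimately have "(h has_sum (p ^ Suc n * s)) UNIV"
      using has_sum_int_reflect by blast
    then have "((\<lambda>r. D n r + h r) has_sum (s + p ^ Suc n * s)) UNIV"
      by (intro has_sum_add that)
    moreover have "D n r + h r = (1 - p ^ (2 * n + 2)) * E (Suc n) r" for r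
    proof -
      have "D n r + h r = slater_coeff p r * (rfact p (int n - 2 * r) * rfact p (int n + 1 + 2 * r) +
          p powi (int n + 1 - 2 * r) * (rfact p (int n + 1 - 2 * r) * rfact p (int n + 2 * r)))"
        by (simp only: D_def h_def distrib_left mult_ac)
      then show ?thesis
        by (simp only: rfact_pascal_even[OF p, symmetric] E_def) (simp only: mult_ac)
    qed
    ultimately have "(E (Suc n) has_sum ((s + p ^ Suc n * s) / (1 - p ^ (2 * n + 2)))) UNIV"
      by (rule has_sum_cancel_factor) (use nz(1)[of "2 * n + 1"] in simp)
    then show ?thesis by (simp add: distrib_right)
  qed
  have E: "(E n has_sum (qpoch (- p) p n / qpoch p p (2 * n))) UNIV" for n
  proof (induction n)
    case 0
    have "E 0 r = (if r = 0 then 1 else 0)" for r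
      by (auto simp: E_def slater_coeff_def rfact_def)
    then have "(E 0 has_sum 1) UNIV"
      by (intro has_sum_finite_neutralI[of "{0}"]) auto
    then show ?case by simp
  next
    case (Suc n)
    have "(1 + p ^ Suc n) * (qpoch (- p) p n / qpoch p p (2 * n) / (1 - p ^ (2 * n + 1))) / (1 - p ^ (2 * n + 2))
        = qpoch (- p) p (Suc n) / qpoch p p (2 * Suc n)"
      by (simp add: qpoch_Suc algebra_simps)
    then show ?case
      using DE[OF ED[OF Suc]] by simp
  qed
  show "((\<lambda>r. slater_coeff p r * (rfact p (int n - 2 * r) * rfact p (int n + 2 * r)))
            has_sum (qpoch (- p) p n / qpoch p p (2 * n))) UNIV"
    using E[of n] by (simp add: E_def[abs_def])
  show "((\<lambda>r. slater_coeff p r * (rfact p (int n - 2 * r) * rfact p (int n + 1 + 2 * r)))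
            has_sum (qpoch (- p) p n / qpoch p p (2 * n + 1))) UNIV"
    using ED[OF E[of n]] by (simp add: D_def[abs_def] qpoch_Suc)
qed

section \<open>Jacobi's triple product\<close>

text \<open>With the sign built in, the product side of the triple product has the factors 1 - z
  p^(2k+1) and 1 - p^(2k+1)/z, and its base is p^2.\<close>

definition theta_term :: "complex \<Rightarrow> complex \<Rightarrow> int \<Rightarrow> complex" where
  "theta_term p z j = (-1) powi j * z powi j * p powi (j ^ 2)"

lemma theta_term_shift:
  assumes "p \<noteq> 0" "z \<noteq> 0"
  shows "theta_term p z (j + 1) = - z * p powi (2 * j + 1) * theta_term p z j"
proof -
  have "(j + 1) ^ 2 = 2 * j + 1 + j ^ 2"
    by (simp add: power2_eq_square algebra_simps)
  then have "p powi ((j + 1) ^ 2) = p powi (2 * j + 1) * p powi (j ^ 2)"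
    using assms by (simp only: power_int_add simp_thms)
  then show ?thesis
    using assms by (simp add: theta_term_def power_int_add[of z] power_int_add[of "-1"])
qed

lemma theta_term_abs_summable:
  assumes p: "norm p < 1" "p \<noteq> 0"
  shows "(\<lambda>j. norm (theta_term p z j)) summable_on UNIV"
proof -
  have nat: "(\<lambda>n::nat. norm (x ^ n * p ^ (n ^ 2))) summable_on UNIV" for x
  proof -
    \<comment> \<open>This brings the square exponent into the shape of
      \<open>summable_power_choose_two\<close>; the two halves of the integers then use it with
      \<open>z\<close> and with \<open>inverse z\<close>.\<close>
    have "n ^ 2 = 2 * (n choose 2) + n" for n :: nat
      by (induction n) (simp_all add: numeral_2_eq_2)
    then have "norm (x ^ n * p ^ (n ^ 2)) = norm ((norm x * norm p) ^ n * (norm p ^ 2) ^ (n choose 2))" for n :: nat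
      by (simp add: norm_mult norm_power power_add power_mult power_mult_distrib)
    moreover have "summable (\<lambda>n. (norm x * norm p) ^ n * (norm p ^ 2) ^ (n choose 2))"
      using p by (intro summable_power_choose_two) (auto simp: power_less_one_iff)
    ultimately have "summable (\<lambda>n. norm (norm (x ^ n * p ^ (n ^ 2))))"
      by (simp add: norm_mult norm_power)
    then show ?thesis
      by (rule norm_summable_imp_summable_on)
  qed
  have "(\<lambda>j. norm (theta_term p z j)) summable_on range int"
    using nat[of z] by (subst summable_on_reindex)
      (auto simp: o_def theta_term_def norm_mult norm_power norm_power_int simp flip: of_nat_power)
  moreover have "(\<lambda>j. norm (theta_term p z j)) summable_on range (\<lambda>n. - int n)"
    using nat[of "inverse z"] by (subst summable_on_reindex)
      (auto simp: o_def inj_on_def theta_term_def norm_mult norm_power norm_power_int norm_inverse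
         power_int_minus power_inverse simp flip: of_nat_power)
  moreover have "range int \<union> range (\<lambda>n. - int n) = UNIV"
    by (auto simp: image_iff) (metis int_cases2)
  ultimately show ?thesis
    using summable_on_union by metis
qed

text \<open>A finite form of the triple product, equivalent to the q-binomial theorem with a centred
  index. The alternation is that of \<open>slater_pair\<close>, but now the second half of the
  Pascal expansion is the first half shifted by one index. The step \<open>ED\<close> thereby
  contributes the factor \<open>1 - p / z * b ^ n\<close> and \<open>DE\<close> the factor
  \<open>1 - z * p * b ^ n\<close>.\<close>

lemma finite_triple_product:
  assumes p: "norm p < 1" "p \<noteq> 0" and z: "z \<noteq> 0"
  shows "((\<lambda>j. theta_term p z j * (rfact (p ^ 2) (int n - j) * rfact (p ^ 2) (int n + j)))
      has_sum (qpoch (z * p) (p ^ 2) n * qpoch (p / z) (p ^ 2) n / qpoch (p ^ 2) (p ^ 2) (2 * n))) UNIV"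
proof -
  define b where "b = p ^ 2"
  have b: "norm b < 1" "b \<noteq> 0"
    using p by (simp_all add: b_def norm_power power_less_one_iff)
  have bp: "b powi k = p powi (2 * k)" for k
    by (simp add: b_def power_int_mult)
  define E where "E n j = theta_term p z j * (rfact b (int n - j) * rfact b (int n + j))" for n j
  define D where "D n j = theta_term p z j * (rfact b (int n - j) * rfact b (int n + 1 + j))" for n j
  have nz: "1 - b ^ Suc k \<noteq> 0" for k
    using self_mult_power_neq_one[OF b(1), of k] by auto
  have ED: "(D n has_sum ((1 - p / z * b ^ n) * s / (1 - b ^ (2 * n + 1)))) UNIV" if "(E n has_sum s) UNIV" for n s
  proof -
    define h where "h j = theta_term p z j * (b powi (int n + 1 + j) *
      (rfact b (int n + 1 + j) * rfact b (int n - j - 1)))" for j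
    have "- (p / z * b ^ n) * E n (j + 1) = h j" for j
    proof -
      have "p * b ^ n * p powi (2 * j + 1) = b powi (int n + 1 + j)"
      proof -
        have "p * b ^ n * p powi (2 * j + 1) = p powi 1 * p powi (2 * int n) * p powi (2 * j + 1)"
          using bp[of "int n"] by simp
        also have "\<dots> = p powi (1 + 2 * int n + (2 * j + 1))"
          using p by (simp only: power_int_add simp_thms)
        also have "1 + 2 * int n + (2 * j + 1) = 2 * (int n + 1 + j)" by simp
        finally show ?thesis by (simp only: bp)
      qed
      moreover have "- (p / z * b ^ n) * theta_term p z (j + 1)
          = theta_term p z j * (p * b ^ n * p powi (2 * j + 1))"
        using z p by (simp add: theta_term_shift)
      ultimately have coeff: "- (p / z * b ^ n) * theta_term p z (j + 1)
          = theta_term p z j * b powi (int n + 1 + j)"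
        by simp
      have "int n - (j + 1) = int n - j - 1" "int n + (j + 1) = int n + 1 + j" by simp_all
      then have "- (p / z * b ^ n) * E n (j + 1) = - (p / z * b ^ n) * theta_term p z (j + 1) *
          (rfact b (int n + 1 + j) * rfact b (int n - j - 1))"
        by (simp only: E_def mult_ac)
      then show ?thesis
        unfolding coeff h_def by (simp only: mult.assoc)
    qed
    moreover have "((\<lambda>j. - (p / z * b ^ n) * E n j) has_sum (- (p / z * b ^ n) * s)) UNIV"
      by (intro has_sum_cmult_right that)
    ultimately have "(h has_sum (- (p / z * b ^ n) * s)) UNIV"
      by (rule has_sum_int_shift[rotated])
    then have "((\<lambda>j. E n j + h j) has_sum (s + - (p / z * b ^ n) * s)) UNIV"
      by (intro has_sum_add that)
    moreover have "E n j + h j = (1 - b ^ (2 * n + 1)) * D n j" for j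
    proof -
      have "E n j + h j = theta_term p z j * (rfact b (int n - j) * rfact b (int n + j) +
          b powi (int n + 1 + j) * (rfact b (int n + 1 + j) * rfact b (int n - j - 1)))"
        by (simp only: E_def h_def distrib_left)
      then show ?thesis
        by (simp only: rfact_pascal_odd[OF b, symmetric] D_def) (simp only: mult_ac)
    qed
    ultimately have "(D n has_sum ((s + - (p / z * b ^ n) * s) / (1 - b ^ (2 * n + 1)))) UNIV"
      by (rule has_sum_cancel_factor) (use nz[of "2 * n"] in simp)
    then show ?thesis by (simp add: left_diff_distrib)
  qed
  have DE: "(E (Suc n) has_sum ((1 - z * p * b ^ n) * s / (1 - b ^ (2 * n + 2)))) UNIV" if "(D n has_sum s) UNIV" for n s
  proof -
    define h where "h j = theta_term p z j * (b powi (int n + 1 - j) *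
      (rfact b (int n + 1 - j) * rfact b (int n + j)))" for j
    have "- (z * p * b ^ n) * D n (j + (- 1)) = h j" for j
    proof -
      have "p powi (2 * (j - 1) + 1) * b powi (int n + 1 - j) = p * b ^ n"
      proof -
        have "p powi (2 * (j - 1) + 1) * b powi (int n + 1 - j)
            = p powi (2 * (j - 1) + 1 + 2 * (int n + 1 - j))"
          using p by (simp only: power_int_add bp simp_thms)
        also have "2 * (j - 1) + 1 + 2 * (int n + 1 - j) = 1 + 2 * int n" by simp
        also have "p powi (1 + 2 * int n) = p powi 1 * p powi (2 * int n)"
          using p by (simp only: power_int_add simp_thms)
        also have "\<dots> = p * b ^ n" using bp[of "int n"] by simp
        finally show ?thesis .
      qed
      moreover have "theta_term p z j * b powi (int n + 1 - j)
          = - z * (p powi (2 * (j - 1) + 1) * b powi (int n + 1 - j)) * theta_term p z (j - 1)"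
        using theta_term_shift[OF p(2) z, of "j - 1"] by simp
      ultimately have coeff: "- (z * p * b ^ n) * theta_term p z (j - 1)
          = theta_term p z j * b powi (int n + 1 - j)"
        by simp
      have "int n - (j + (- 1)) = int n + 1 - j" "int n + 1 + (j + (- 1)) = int n + j" "j + (- 1) = j - 1"
        by simp_all
      then have "- (z * p * b ^ n) * D n (j + (- 1)) = - (z * p * b ^ n) * theta_term p z (j - 1) *
          (rfact b (int n + 1 - j) * rfact b (int n + j))"
        by (simp only: D_def mult_ac)
      then show ?thesis
        unfolding coeff h_def by (simp only: mult.assoc)
    qed
    moreover have "((\<lambda>j. - (z * p * b ^ n) * D n j) has_sum (- (z * p * b ^ n) * s)) UNIV"
      by (intro has_sum_cmult_right that)
    ultimately have "(h has_sum (- (z * p * b ^ n) * s)) UNIV"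
      by (rule has_sum_int_shift[rotated])
    then have "((\<lambda>j. D n j + h j) has_sum (s + - (z * p * b ^ n) * s)) UNIV"
      by (intro has_sum_add that)
    moreover have "D n j + h j = (1 - b ^ (2 * n + 2)) * E (Suc n) j" for j
    proof -
      have "D n j + h j = theta_term p z j * (rfact b (int n - j) * rfact b (int n + 1 + j) +
          b powi (int n + 1 - j) * (rfact b (int n + 1 - j) * rfact b (int n + j)))"
        by (simp only: D_def h_def distrib_left)
      then show ?thesis
        by (simp only: rfact_pascal_even[OF b, symmetric] E_def) (simp only: mult_ac)
    qed
    ultimately have "(E (Suc n) has_sum ((s + - (z * p * b ^ n) * s) / (1 - b ^ (2 * n + 2)))) UNIV"
      by (rule has_sum_cancel_factor) (use nz[of "2 * n + 1"] in simp)
    then show ?thesis by (simp add: left_diff_distrib)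
  qed
  have "(E n has_sum (qpoch (z * p) b n * qpoch (p / z) b n / qpoch b b (2 * n))) UNIV"
  proof (induction n)
    case 0
    have "E 0 j = (if j = 0 then 1 else 0)" for j
      by (auto simp: E_def theta_term_def rfact_def)
    then have "(E 0 has_sum 1) UNIV"
      by (intro has_sum_finite_neutralI[of "{0}"]) auto
    then show ?case by simp
  next
    case (Suc n)
    have "(1 - z * p * b ^ n) * ((1 - p / z * b ^ n) * (qpoch (z * p) b n * qpoch (p / z) b n / qpoch b b (2 * n))
          / (1 - b ^ (2 * n + 1))) / (1 - b ^ (2 * n + 2))
        = qpoch (z * p) b (Suc n) * qpoch (p / z) b (Suc n) / qpoch b b (2 * Suc n)"
      by (simp add: qpoch_Suc)
    then show ?case
      using DE[OF ED[OF Suc]] by simp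
  qed
  then show ?thesis by (simp add: E_def[abs_def] b_def)
qed

text \<open>The limit of the finite form: both reciprocal factorials are bounded and tend to
  1/(p^2;p^2)_infinity for each fixed index, and the theta series converges absolutely, so Tannery's
  theorem applies.\<close>

theorem jacobi_triple_product:
  assumes p: "norm p < 1" "p \<noteq> 0" and z: "z \<noteq> 0"
  shows "(theta_term p z has_sum
      (qpoch_inf (p ^ 2) (p ^ 2) * qpoch_inf (z * p) (p ^ 2) * qpoch_inf (p / z) (p ^ 2))) UNIV"
proof -
  define b where "b = p ^ 2"
  have b: "norm b < 1"
    using p by (simp add: b_def norm_power power_less_one_iff)
  define q where "q = qpoch_inf b b"
  have q: "q \<noteq> 0"
    unfolding q_def using b self_mult_power_neq_one by (intro qpoch_inf_nonzero) auto
  obtain C where C: "C > 0" "\<And>k. norm (rfact b k) \<le> C"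
    using rfact_bounded[OF b] by metis
  \<comment> \<open>The integers are enumerated by \<open>int_decode\<close>, because Tannery's
    theorem is applied to series over the naturals.\<close>
  define c where "c k = theta_term p z (int_decode k)" for k
  define f where "f n k = c k * (rfact b (int n - int_decode k) * rfact b (int n + int_decode k))" for n k
  have "(\<lambda>j. norm (theta_term p z j)) summable_on UNIV"
    using p by (rule theta_term_abs_summable)
  then obtain s where s: "(theta_term p z has_sum s) UNIV" and "(\<lambda>j. norm (theta_term p z j)) summable_on UNIV"
    using abs_summable_summable summable_on_def by metis
  then have "((\<lambda>k. norm (c k)) has_sum infsum (\<lambda>j. norm (theta_term p z j)) UNIV) UNIV"
    unfolding c_def by (subst has_sum_reindex_bij_betw[OF bij_int_decode]) simp
  then have "summable (\<lambda>k. norm (c k))"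
    using has_sum_imp_sums sums_summable by blast
  then have sm: "summable (\<lambda>k. norm (c k) * (C * C))"
    by (rule summable_mult2)
  have "(c has_sum s) UNIV"
    using s unfolding c_def by (subst has_sum_reindex_bij_betw[OF bij_int_decode])
  then have c: "c sums s" by (rule has_sum_imp_sums)
  have f: "suminf (f n) = qpoch (z * p) b n * qpoch (p / z) b n / qpoch b b (2 * n)" for n
  proof -
    have "(f n has_sum (qpoch (z * p) b n * qpoch (p / z) b n / qpoch b b (2 * n))) UNIV"
      unfolding f_def c_def b_def
      using has_sum_reindex_bij_betw[OF bij_int_decode, THEN iffD2, OF finite_triple_product[OF p z]] .
    then show ?thesis using has_sum_imp_sums sums_unique by metis
  qed
  have "(\<lambda>n. f n k) \<longlonglongrightarrow> c k * (inverse q * inverse q)" for k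
    unfolding f_def q_def using rfact_LIMSEQ[OF b, of "- int_decode k"] rfact_LIMSEQ[OF b, of "int_decode k"]
    by (intro tendsto_intros) simp_all
  moreover have "norm (f n k) \<le> norm (c k) * (C * C)" for n k
    unfolding f_def norm_mult using C by (intro mult_left_mono mult_mono) (auto intro: less_imp_le)
  ultimately have "(\<lambda>n. suminf (f n)) \<longlonglongrightarrow> (\<Sum>k. c k * (inverse q * inverse q))"
    by (intro tannery_sequentially[OF _ _ sm])
  also have "(\<Sum>k. c k * (inverse q * inverse q)) = s * (inverse q * inverse q)"
    using sums_unique[OF sums_mult2[OF c]] by metis
  finally have "(\<lambda>n. suminf (f n)) \<longlonglongrightarrow> s * (inverse q * inverse q)" .
  moreover have "(\<lambda>n. suminf (f n)) \<longlonglongrightarrow> qpoch_inf (z * p) b * qpoch_inf (p / z) b / q"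
  proof -
    have "(\<lambda>n. qpoch b b (2 * n)) \<longlonglongrightarrow> q"
      using LIMSEQ_subseq_LIMSEQ[OF qpoch_LIMSEQ[OF b, of b], of "\<lambda>n. 2 * n"]
      by (simp add: o_def strict_mono_def q_def)
    then show ?thesis
      unfolding f using b q by (intro tendsto_intros qpoch_LIMSEQ)
  qed
  ultimately have "s * (inverse q * inverse q) = qpoch_inf (z * p) b * qpoch_inf (p / z) b / q"
    using LIMSEQ_unique by blast
  then have "s = q * qpoch_inf (z * p) b * qpoch_inf (p / z) b"
    using q by (simp add: field_simps)
  then show ?thesis
    using s by (simp add: q_def b_def)
qed

section \<open>Summation of the Bailey pair\<close>

text \<open>The parameter \<open>d\<close> treats two conjugate Bailey pairs in base q^2 at once,
  relative to 1 for \<open>d = 0\<close> and to q^2 for \<open>d = 1\<close>. The terms with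
  \<open>n < s\<close> vanish. Substituting \<open>n = k + s\<close> turns the others into the
  q-Gauss sum, with \<open>K\<close> as the term at \<open>n = s\<close>.\<close>

lemma conjugate_pair_nat:
  assumes q: "norm q < 1" "q \<noteq> 0"
  shows "((\<lambda>n. q ^ (n ^ 2) * qpoch (- q) (q ^ 2) (n + d) *
          (rfact (q ^ 2) (int n - int s) * rfact (q ^ 2) (int n + int s + int d)))
      has_sum (q ^ (s ^ 2) * qpoch (- q) (q ^ 2) (s + d) * qpoch_inf (- q * (q ^ 2) ^ s) (q ^ 2)
        / qpoch_inf (q ^ 2) (q ^ 2))) UNIV"
proof -
  define b where "b = q ^ 2"
  have b: "norm b < 1"
    using q by (simp add: b_def norm_power power_less_one_iff)
  define c where "c = b * b ^ (2 * s + d)"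
  define x where "x = - q * b ^ s"
  define K where "K = q ^ (s ^ 2) * qpoch (- q) b (s + d) / qpoch b b (2 * s + d)"
  define f where "f n = q ^ (n ^ 2) * qpoch (- q) b (n + d) *
      (rfact b (int n - int s) * rfact b (int n + int s + int d))" for n
  have c: "c * b ^ k \<noteq> 1" for k
    using self_mult_power_neq_one[OF b, of "2 * s + d + k"] by (simp add: c_def power_add mult_ac)
  have f: "K * gauss_term b c x k = f (k + s)" for k
  proof -
    have "c * b ^ i - x = q ^ (2 * s + 1) * (1 - (- q * b ^ (s + d)) * b ^ i)" for i
    proof -
      have "c * b ^ i = q ^ (2 + 2 * (2 * s + d) + 2 * i)"
        by (simp only: c_def b_def power_add power_mult)
      also have "2 + 2 * (2 * s + d) + 2 * i = (2 * s + 1) + (1 + 2 * (s + d) + 2 * i)"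
        by simp
      also have "q ^ ((2 * s + 1) + (1 + 2 * (s + d) + 2 * i)) = q ^ (2 * s + 1) * (q * b ^ (s + d) * b ^ i)"
        by (simp only: b_def power_add power_mult power_one_right)
      finally have "c * b ^ i = q ^ (2 * s + 1) * (q * b ^ (s + d) * b ^ i)" .
      moreover have "x = - (q ^ (2 * s + 1))"
        by (simp add: x_def b_def power_mult)
      ultimately show ?thesis
        by (simp add: distrib_left)
    qed
    then have 1: "(\<Prod>i<k. c * b ^ i - x) = q ^ ((2 * s + 1) * k) * qpoch (- q * b ^ (s + d)) b k"
      by (simp only: prod.distrib qpoch_def prod_constant card_lessThan power_mult)
    \<comment> \<open>The powers of \<open>q\<close> coming from \<open>K\<close>, from the product
      and from the quadratic factor of the q-Gauss term complete the square required by the weight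
      at \<open>k + s\<close>.\<close>
    have "(s ^ 2) + (2 * s + 1) * k + 2 * (k choose 2) = (k + s) ^ 2"
      by (induction k) (simp_all add: numeral_2_eq_2 algebra_simps)
    then have 2: "q ^ (s ^ 2) * (q ^ ((2 * s + 1) * k) * b ^ (k choose 2)) = q ^ ((k + s) ^ 2)"
      by (simp only: b_def power_mult[symmetric] power_add[symmetric] add.assoc)
    have 3: "qpoch (- q) b (k + s + d) = qpoch (- q) b (s + d) * qpoch (- q * b ^ (s + d)) b k"
      using qpoch_add[of "- q" b "s + d" k] by (simp add: add_ac)
    have 4: "qpoch b b (2 * s + d + k) = qpoch b b (2 * s + d) * qpoch c b k"
      using qpoch_add[of b b "2 * s + d" k] by (simp add: c_def)
    have "int (k + s) - int s = int k" "int (k + s) + int s + int d = int (2 * s + d + k)" by simp_all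
    then have "f (k + s) = q ^ ((k + s) ^ 2) * qpoch (- q) b (k + s + d) *
        (inverse (qpoch b b k) * inverse (qpoch b b (2 * s + d + k)))"
      by (simp only: f_def rfact_int)
    then show ?thesis
      unfolding 2[symmetric] 3 4 K_def gauss_term_def 1 by (simp add: field_simps)
  qed
  have "K * (qpoch_inf x b / qpoch_inf c b) = q ^ (s ^ 2) * qpoch (- q) b (s + d) * qpoch_inf x b / qpoch_inf b b"
    using qpoch_inf_shift[OF b, of b "2 * s + d"] unfolding K_def c_def[symmetric] by (simp add: field_simps)
  moreover have "(\<lambda>k. K * gauss_term b c x k) sums (K * (qpoch_inf x b / qpoch_inf c b))"
    by (intro sums_mult gauss_term_sums b c)
  moreover have "summable (\<lambda>k. norm (K * gauss_term b c x k))"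
    unfolding norm_mult by (intro summable_mult summable_gauss_term b c)
  ultimately have "((\<lambda>k. f (k + s)) has_sum
      (q ^ (s ^ 2) * qpoch (- q) b (s + d) * qpoch_inf x b / qpoch_inf b b)) UNIV"
    unfolding f by (metis norm_summable_imp_has_sum)
  moreover have "bij_betw (\<lambda>k. k + s) UNIV {s..}"
    by (rule bij_betwI[where g = "\<lambda>n. n - s"]) auto
  ultimately have "(f has_sum (q ^ (s ^ 2) * qpoch (- q) b (s + d) * qpoch_inf x b / qpoch_inf b b)) {s..}"
    using has_sum_reindex_bij_betw by blast
  then have "(f has_sum (q ^ (s ^ 2) * qpoch (- q) b (s + d) * qpoch_inf x b / qpoch_inf b b)) UNIV"
    by (subst has_sum_cong_neutral[where T = "{s..}" and g = f]) (auto simp: f_def)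
  then show ?thesis
    by (simp only: f_def[abs_def] b_def x_def)
qed

text \<open>For \<open>d = 0\<close> the finite and the infinite product merge by
  \<open>qpoch_inf_shift\<close>, so only the power of \<open>q\<close> depends on \<open>j\<close>.
  Negative \<open>j\<close> follow from the symmetry of the kernel under \<open>j\<close> to
  \<open>- j\<close>.\<close>

lemma conjugate_pair_even:
  assumes q: "norm q < 1" "q \<noteq> 0"
  shows "((\<lambda>n. q ^ (n ^ 2) * qpoch (- q) (q ^ 2) n * (rfact (q ^ 2) (int n - j) * rfact (q ^ 2) (int n + j)))
      has_sum (q powi (j ^ 2) * (qpoch_inf (- q) (q ^ 2) / qpoch_inf (q ^ 2) (q ^ 2)))) UNIV"
proof -
  have b: "norm (q ^ 2) < 1"
    using q by (simp add: norm_power power_less_one_iff)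
  have nat: "((\<lambda>n. q ^ (n ^ 2) * qpoch (- q) (q ^ 2) n * (rfact (q ^ 2) (int n - int s) * rfact (q ^ 2) (int n + int s)))
      has_sum (q ^ (s ^ 2) * (qpoch_inf (- q) (q ^ 2) / qpoch_inf (q ^ 2) (q ^ 2)))) UNIV" for s
    using conjugate_pair_nat[OF q, of 0 s] qpoch_inf_shift[OF b, of "- q" s]
    by (simp add: mult.assoc)
  show ?thesis
  proof (cases j rule: int_cases2)
    case (nonneg s)
    then show ?thesis using nat[of s] by (simp flip: of_nat_power)
  next
    case (nonpos s)
    then show ?thesis using nat[of s] by (simp add: mult_ac flip: of_nat_power)
  qed
qed

text \<open>For \<open>d = 1\<close> the merging leaves one factor 1 + q^(2s+1), which splits
  q^(s^2) into the two square powers. The kernel is symmetric under \<open>j\<close> to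
  \<open>- 1 - j\<close>, which exchanges these two powers.\<close>

lemma conjugate_pair_odd:
  assumes q: "norm q < 1" "q \<noteq> 0"
  shows "((\<lambda>n. q ^ (n ^ 2) * qpoch (- q) (q ^ 2) (n + 1) *
          (rfact (q ^ 2) (int n - j) * rfact (q ^ 2) (int n + 1 + j)))
      has_sum ((q powi (j ^ 2) + q powi ((j + 1) ^ 2)) *
        (qpoch_inf (- q) (q ^ 2) / qpoch_inf (q ^ 2) (q ^ 2)))) UNIV"
proof -
  have b: "norm (q ^ 2) < 1"
    using q by (simp add: norm_power power_less_one_iff)
  have nat: "((\<lambda>n. q ^ (n ^ 2) * qpoch (- q) (q ^ 2) (n + 1) *
          (rfact (q ^ 2) (int n - int s) * rfact (q ^ 2) (int n + 1 + int s)))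
      has_sum ((q ^ (s ^ 2) + q ^ ((s + 1) ^ 2)) *
        (qpoch_inf (- q) (q ^ 2) / qpoch_inf (q ^ 2) (q ^ 2)))) UNIV" for s
  proof -
    have "q ^ (s ^ 2) * (1 + q * (q ^ 2) ^ s) = q ^ (s ^ 2) + q ^ ((s + 1) ^ 2)"
      by (simp add: algebra_simps power2_eq_square flip: power_add power_mult)
    then have "q ^ (s ^ 2) * qpoch (- q) (q ^ 2) (s + 1) * qpoch_inf (- q * (q ^ 2) ^ s) (q ^ 2)
        = (q ^ (s ^ 2) + q ^ ((s + 1) ^ 2)) * qpoch_inf (- q) (q ^ 2)"
      unfolding qpoch_inf_shift[OF b, of "- q" s, symmetric] by (simp add: qpoch_Suc mult_ac)
    moreover have "int n + int s + int 1 = int n + 1 + int s" for n by simp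
    ultimately show ?thesis
      using conjugate_pair_nat[OF q, of 1 s] by (simp only: times_divide_eq_right)
  qed
  show ?thesis
  proof (cases "j \<ge> 0")
    case True
    then obtain s where "j = int s" by (metis nonneg_int_cases)
    moreover have "q powi ((int s) ^ 2) = q ^ (s ^ 2)" "q powi ((int s + 1) ^ 2) = q ^ ((s + 1) ^ 2)"
      unfolding power_int_of_nat[symmetric] by (simp_all add: algebra_simps)
    ultimately show ?thesis using nat[of s] by simp
  next
    case False
    then obtain s where j: "j = - 1 - int s"
      by (metis add.commute diff_minus_eq_add minus_diff_eq not_le zless_iff_Suc_zadd negD of_nat_Suc uminus_add_conv_diff)
    have "(- 1 - int s) ^ 2 = int ((s + 1) ^ 2)" "(- 1 - int s + 1) ^ 2 = int (s ^ 2)"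
      by (simp_all add: power2_eq_square algebra_simps)
    then have "q powi (j ^ 2) = q ^ ((s + 1) ^ 2)" "q powi ((j + 1) ^ 2) = q ^ (s ^ 2)"
      unfolding j by (simp_all only: power_int_of_nat)
    moreover have "rfact (q ^ 2) (int n - j) * rfact (q ^ 2) (int n + 1 + j)
        = rfact (q ^ 2) (int n - int s) * rfact (q ^ 2) (int n + 1 + int s)" for n
    proof -
      have "int n - j = int n + 1 + int s" "int n + 1 + j = int n - int s"
        by (simp_all add: j)
      then show ?thesis by (simp only: mult.commute)
    qed
    ultimately show ?thesis
      using nat[of s] by (simp only: add.commute)
  qed
qed

text \<open>Bailey's transform in abstract form. A bounded kernel \<open>R\<close> keeps the double
  series absolutely convergent, so it may be summed by rows or by columns.\<close>

lemma has_sum_swap_bounded: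
  fixes a :: "'a \<Rightarrow> complex" and \<alpha> :: "'b \<Rightarrow> complex"
  assumes a: "(\<lambda>n. norm (a n)) summable_on UNIV"
    and \<alpha>: "(\<lambda>r. norm (\<alpha> r)) summable_on UNIV"
    and R: "\<And>n r. norm (R n r) \<le> C"
    and rows: "\<And>n. ((\<lambda>r. \<alpha> r * R n r) has_sum \<beta> n) UNIV"
    and cols: "\<And>r. ((\<lambda>n. a n * R n r) has_sum \<gamma> r) UNIV"
    and S: "((\<lambda>r. \<alpha> r * \<gamma> r) has_sum S) UNIV"
  shows "((\<lambda>n. a n * \<beta> n) has_sum S) UNIV"
proof -
  define F where "F = (\<lambda>(n, r). a n * \<alpha> r * R n r)"
  have "(\<lambda>(n, r). norm (a n) * norm (\<alpha> r)) summable_on (UNIV \<times> UNIV)"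
    by (rule summable_on_SigmaI[where g = "\<lambda>n. norm (a n) * infsum (\<lambda>r. norm (\<alpha> r)) UNIV"])
       (auto intro!: has_sum_cmult_right has_sum_infsum \<alpha> summable_on_cmult_left a)
  then have "(\<lambda>x. (case x of (n, r) \<Rightarrow> norm (a n) * norm (\<alpha> r)) * C) summable_on (UNIV \<times> UNIV)"
    by (rule summable_on_cmult_left)
  then have "(\<lambda>x. norm (F x)) summable_on (UNIV \<times> UNIV)"
    by (rule Infinite_Sum.abs_summable_on_comparison_test') (auto simp: F_def norm_mult intro!: mult_left_mono R)
  then obtain S' where S': "(F has_sum S') (UNIV \<times> UNIV)"
    using abs_summable_summable summable_on_def by metis
  have rowsF: "((\<lambda>n. a n * \<beta> n) has_sum S') UNIV"
  proof (rule has_sum_Sigma'[OF S'])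
    fix n show "((\<lambda>r. F (n, r)) has_sum a n * \<beta> n) UNIV"
      using has_sum_cmult_right[OF rows, of "a n" n] by (simp add: F_def mult.assoc)
  qed
  have "((\<lambda>r. \<alpha> r * \<gamma> r) has_sum S') UNIV"
  proof (rule has_sum_Sigma'[OF S'[unfolded has_sum_swap[of F]]])
    fix r show "((\<lambda>n. (case (r, n) of (x, y) \<Rightarrow> F (y, x))) has_sum \<alpha> r * \<gamma> r) UNIV"
      using has_sum_cmult_right[OF cols, of "\<alpha> r" r] by (simp add: F_def mult_ac)
  qed
  then show ?thesis
    using rowsF S has_sum_unique by blast
qed

section \<open>Absolute convergence of the weights, and the coefficients as theta terms\<close>

lemma summable_norm_square_power:
  assumes "norm q < 1"
  shows "summable (\<lambda>n. norm (q :: complex) ^ (n ^ 2))"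
proof (rule summable_comparison_test)
  show "summable (\<lambda>n. norm q ^ n)"
    using assms by (intro summable_geometric) simp
  show "\<exists>N. \<forall>n\<ge>N. norm (norm q ^ n\<^sup>2) \<le> norm q ^ n"
    using assms by (auto intro!: power_decreasing self_le_power simp: power2_eq_square)
qed

lemma slater_weight_abs_summable:
  assumes "norm q < 1"
  shows "(\<lambda>n. norm (q ^ (n ^ 2) * qpoch (- q) (q ^ 2) (n + d))) summable_on UNIV"
proof -
  have "norm (q ^ 2) < 1"
    using assms by (simp add: norm_power power_less_one_iff)
  then obtain C where C: "\<And>n. norm (qpoch (- q) (q ^ 2) n) \<le> C"
    using qpoch_bounded by metis
  have "summable (\<lambda>n. norm (norm (q ^ (n ^ 2) * qpoch (- q) (q ^ 2) (n + d))))"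
  proof (rule summable_comparison_test)
    show "summable (\<lambda>n. norm q ^ (n ^ 2) * C)"
      by (intro summable_mult2 summable_norm_square_power assms)
    show "\<exists>N. \<forall>n\<ge>N. norm (norm (norm (q ^ (n ^ 2) * qpoch (- q) (q ^ 2) (n + d)))) \<le> norm q ^ (n ^ 2) * C"
      using C by (auto simp: norm_mult norm_power intro!: mult_left_mono)
  qed
  then show ?thesis
    by (rule norm_summable_imp_summable_on)
qed

lemma slater_coeff_eq_theta_term:
  assumes "q \<noteq> 0"
  shows "slater_coeff (q ^ 2) r = theta_term (q ^ 6) (q ^ 2) r"
proof -
  have "(q ^ 2) powi (3 * r ^ 2 + r) = q powi (2 * r + 6 * r ^ 2)"
    using power_int_mult[of q 2 "3 * r ^ 2 + r"] by (simp add: algebra_simps)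
  moreover have "(q ^ 2) powi r * (q ^ 6) powi (r ^ 2) = q powi (2 * r + 6 * r ^ 2)"
    using power_int_mult[of q 2 r] power_int_mult[of q 6 "r ^ 2"] assms by (simp add: power_int_add)
  ultimately show ?thesis
    by (simp add: slater_coeff_def theta_term_def)
qed

lemma theta_term_powi:
  assumes "q \<noteq> 0"
  shows "theta_term (q ^ a) (q ^ b) r = (-1) powi r * q powi (int b * r + int a * r ^ 2)"
  using assms power_int_mult[of q "int b" r] power_int_mult[of q "int a" "r ^ 2"]
  by (simp add: theta_term_def power_int_add)

text \<open>The two series at m = 0. The kernel index is 2r, so the column sums carry q^(4r^2), and
  in the odd case also q^((2r+1)^2). Together with the coefficient exponent 6r^2 + 2r this gives
  10r^2 + 2r and 1 + 10r^2 + 6r, and both theta series are products by Jacobi's identity.\<close>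

lemma slater_mod_twenty:
  assumes q: "norm q < 1" "q \<noteq> 0"
  shows "(\<lambda>n. q ^ (n ^ 2) / qpoch q q (2 * n)) sums
    (qpochs_inf [q ^ 8, q ^ 12, q ^ 20] (q ^ 20) * (qpoch_inf (- q) (q ^ 2) / qpoch_inf (q ^ 2) (q ^ 2)))"
    and "(\<lambda>n. q ^ (n ^ 2) / qpoch q q (2 * n + 1)) sums
    ((qpochs_inf [q ^ 8, q ^ 12, q ^ 20] (q ^ 20) + q * qpochs_inf [q ^ 4, q ^ 16, q ^ 20] (q ^ 20)) *
      (qpoch_inf (- q) (q ^ 2) / qpoch_inf (q ^ 2) (q ^ 2)))"
proof -
  define b where "b = q ^ 2"
  define Z where "Z = qpoch_inf (- q) b / qpoch_inf b b"
  have b: "norm b < 1" "b \<noteq> 0"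
    using q by (simp_all add: b_def norm_power power_less_one_iff)
  have qk: "norm (q ^ k) < 1" "q ^ k \<noteq> 0" if "0 < k" for k
    using q that by (simp_all add: norm_power power_less_one_iff)
  obtain C where C: "C > 0" "\<And>k. norm (rfact b k) \<le> C"
    using rfact_bounded[OF b(1)] by metis
  have CC: "norm (rfact b i * rfact b j) \<le> C * C" for i j
    unfolding norm_mult using C by (intro mult_mono) (auto intro: less_imp_le)
  have \<alpha>: "(\<lambda>r. norm (slater_coeff b r)) summable_on UNIV"
    unfolding b_def slater_coeff_eq_theta_term[OF q(2)] using qk by (intro theta_term_abs_summable) auto
  have "q ^ 10 * q ^ 2 = q ^ 12" "q ^ 10 / q ^ 2 = q ^ 8" "q ^ 10 * q ^ 6 = q ^ 16" "q ^ 10 / q ^ 6 = q ^ 4"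
    using q by (simp_all add: field_simps flip: power_add)
  then have jtp:
    "(theta_term (q ^ 10) (q ^ 2) has_sum qpochs_inf [q ^ 8, q ^ 12, q ^ 20] (q ^ 20)) UNIV"
    "(theta_term (q ^ 10) (q ^ 6) has_sum qpochs_inf [q ^ 4, q ^ 16, q ^ 20] (q ^ 20)) UNIV"
    using jacobi_triple_product[OF qk qk(2), of 10 2] jacobi_triple_product[OF qk qk(2), of 10 6]
    by (simp_all add: qpochs_inf_def mult_ac flip: power_mult)
  have shift1: "slater_coeff b r * q powi ((2 * r) ^ 2) = theta_term (q ^ 10) (q ^ 2) r" for r
    unfolding b_def slater_coeff_eq_theta_term[OF q(2)] theta_term_powi[OF q(2)]
    using q(2) by (simp add: power2_eq_square algebra_simps flip: power_int_add)
  have shift2: "slater_coeff b r * q powi ((2 * r + 1) ^ 2) = q * theta_term (q ^ 10) (q ^ 6) r" for r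
  proof -
    have "q powi (2 * r + 6 * r ^ 2) * q powi ((2 * r + 1) ^ 2) = q powi (1 + (6 * r + 10 * r ^ 2))"
      using q(2) by (simp add: power2_eq_square algebra_simps flip: power_int_add)
    also have "\<dots> = q * q powi (6 * r + 10 * r ^ 2)"
      using q(2) by (subst power_int_add) auto
    finally show ?thesis
      unfolding b_def slater_coeff_eq_theta_term[OF q(2)] theta_term_powi[OF q(2)] by simp
  qed
  have nz: "qpoch q q n \<noteq> 0" for n
    using qpoch_nonzero[OF self_mult_power_neq_one[OF q(1)]] .
  have bnz: "qpoch b b n \<noteq> 0" for n
    using qpoch_nonzero[OF self_mult_power_neq_one[OF b(1)]] .
  have bq: "qpoch b b n = qpoch q q n * qpoch (- q) q n" for n
    unfolding b_def by (rule qpoch_mult_minus[symmetric])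
  have mb: "- q * q = - b" by (simp add: b_def power2_eq_square)
  show "(\<lambda>n. q ^ (n ^ 2) / qpoch q q (2 * n)) sums
    (qpochs_inf [q ^ 8, q ^ 12, q ^ 20] (q ^ 20) * (qpoch_inf (- q) (q ^ 2) / qpoch_inf (q ^ 2) (q ^ 2)))"
  proof -
    have "((\<lambda>n. q ^ (n ^ 2) * qpoch (- q) b n * (qpoch (- b) b n / qpoch b b (2 * n))) has_sum
        (qpochs_inf [q ^ 8, q ^ 12, q ^ 20] (q ^ 20) * Z)) UNIV"
    proof (rule has_sum_swap_bounded[OF _ \<alpha> CC slater_pair(1)[OF b]])
      show "(\<lambda>n. norm (q ^ (n ^ 2) * qpoch (- q) b n)) summable_on UNIV"
        using slater_weight_abs_summable[OF q(1), of 0] by (simp add: b_def)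
      show "((\<lambda>n. q ^ (n ^ 2) * qpoch (- q) b n * (rfact b (int n - 2 * r) * rfact b (int n + 2 * r)))
          has_sum (q powi ((2 * r) ^ 2) * Z)) UNIV" for r
        using conjugate_pair_even[OF q, of "2 * r"] by (simp only: b_def Z_def)
      show "((\<lambda>r. slater_coeff b r * (q powi ((2 * r) ^ 2) * Z)) has_sum
          (qpochs_inf [q ^ 8, q ^ 12, q ^ 20] (q ^ 20) * Z)) UNIV"
        unfolding mult.assoc[symmetric] shift1 by (intro has_sum_cmult_left jtp)
    qed
    \<comment> \<open>Splitting (-q;q)_2n by parity of the exponent gives the two numerator factors,
      and (q^2;q^2)_2n = (q;q)_2n (-q;q)_2n then cancels them against the denominator.\<close>
    moreover have "q ^ (n ^ 2) * qpoch (- q) b n * (qpoch (- b) b n / qpoch b b (2 * n))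
        = q ^ (n ^ 2) / qpoch q q (2 * n)" for n
    proof -
      have "qpoch (- q) q (2 * n) = qpoch (- q) b n * qpoch (- b) b n"
        using qpoch_even[of "- q" q n] by (simp only: b_def[symmetric] mb)
      then show ?thesis
        using bnz[of "2 * n"] nz[of "2 * n"] bq[of "2 * n"] by (simp add: field_simps)
    qed
    ultimately show ?thesis
      using has_sum_imp_sums by (simp add: Z_def b_def)
  qed
  show "(\<lambda>n. q ^ (n ^ 2) / qpoch q q (2 * n + 1)) sums
    ((qpochs_inf [q ^ 8, q ^ 12, q ^ 20] (q ^ 20) + q * qpochs_inf [q ^ 4, q ^ 16, q ^ 20] (q ^ 20)) *
      (qpoch_inf (- q) (q ^ 2) / qpoch_inf (q ^ 2) (q ^ 2)))"
  proof -
    have "((\<lambda>n. q ^ (n ^ 2) * qpoch (- q) b (n + 1) * (qpoch (- b) b n / qpoch b b (2 * n + 1))) has_sum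
        ((qpochs_inf [q ^ 8, q ^ 12, q ^ 20] (q ^ 20) + q * qpochs_inf [q ^ 4, q ^ 16, q ^ 20] (q ^ 20)) * Z)) UNIV"
    proof (rule has_sum_swap_bounded[OF _ \<alpha> CC slater_pair(2)[OF b]])
      show "(\<lambda>n. norm (q ^ (n ^ 2) * qpoch (- q) b (n + 1))) summable_on UNIV"
        unfolding b_def by (rule slater_weight_abs_summable[OF q(1)])
      show "((\<lambda>n. q ^ (n ^ 2) * qpoch (- q) b (n + 1) * (rfact b (int n - 2 * r) * rfact b (int n + 1 + 2 * r)))
          has_sum ((q powi ((2 * r) ^ 2) + q powi ((2 * r + 1) ^ 2)) * Z)) UNIV" for r
        using conjugate_pair_odd[OF q, of "2 * r"] by (simp only: b_def Z_def)
      show "((\<lambda>r. slater_coeff b r * ((q powi ((2 * r) ^ 2) + q powi ((2 * r + 1) ^ 2)) * Z)) has_sum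
          ((qpochs_inf [q ^ 8, q ^ 12, q ^ 20] (q ^ 20) + q * qpochs_inf [q ^ 4, q ^ 16, q ^ 20] (q ^ 20)) * Z)) UNIV"
        unfolding mult.assoc[symmetric] distrib_left shift1 shift2
        by (intro has_sum_cmult_left has_sum_add has_sum_cmult_right jtp)
    qed
    moreover have "q ^ (n ^ 2) * qpoch (- q) b (n + 1) * (qpoch (- b) b n / qpoch b b (2 * n + 1))
        = q ^ (n ^ 2) / qpoch q q (2 * n + 1)" for n
    proof -
      have "qpoch (- q) q (2 * n + 1) = qpoch (- q) b (n + 1) * qpoch (- b) b n"
        using qpoch_odd[of "- q" q n] by (simp only: b_def[symmetric] mb)
      then show ?thesis
        using bnz[of "2 * n + 1"] nz[of "2 * n + 1"] bq[of "2 * n + 1"] by (simp add: field_simps)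
    qed
    ultimately show ?thesis
      using has_sum_imp_sums by (simp add: Z_def b_def)
  qed
qed

text \<open>First (-q;q^2)/(q^2;q^2) = (q^2;q^4)/(q;q) for the infinite products. Then everything is
  written in base q^20: (q^2;q^4) splits into the residues 2, 6, 10, 14, 18, and each product in
  base q^10 into two, so that both sides show the same eight factors.\<close>

lemma slater_product:
  assumes q: "norm q < 1" "q \<noteq> 0"
  shows "qpochs_inf [q ^ 4, q ^ 16, q ^ 20] (q ^ 20) * (qpoch_inf (- q) (q ^ 2) / qpoch_inf (q ^ 2) (q ^ 2))
    = qpochs_inf [q ^ 4, q ^ 6, q ^ 10] (q ^ 10) * qpochs_inf [q ^ 2, q ^ 18] (q ^ 20) / qpoch_inf q q"
proof -
  have qk: "norm (q ^ k) < 1" if "0 < k" for k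
    using q that by (simp add: norm_power power_less_one_iff)
  have qq: "qpoch_inf q q = qpoch_inf q (q ^ 2) * qpoch_inf (q ^ 2) (q ^ 2)"
    using qpoch_inf_dissect[of q 2 q] q by (simp add: numeral_2_eq_2)
  have "qpoch_inf q q \<noteq> 0"
    using q self_mult_power_neq_one by (intro qpoch_inf_nonzero) auto
  then have nz: "qpoch_inf q (q ^ 2) \<noteq> 0" "qpoch_inf (q ^ 2) (q ^ 2) \<noteq> 0"
    unfolding qq by auto
  have "qpoch_inf q (q ^ 2) * qpoch_inf (- q) (q ^ 2) = qpoch_inf (q ^ 2) (q ^ 4)"
    using qpoch_inf_mult_minus[of "q ^ 2" q] qk by (simp flip: power_mult)
  then have Z: "qpoch_inf (- q) (q ^ 2) / qpoch_inf (q ^ 2) (q ^ 2) = qpoch_inf (q ^ 2) (q ^ 4) / qpoch_inf q q"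
    unfolding qq using nz by (simp add: field_simps)
  have "qpoch_inf (q ^ 2) (q ^ 4) = (\<Prod>i<5. qpoch_inf (q ^ (2 + 4 * i)) (q ^ 20))"
  proof -
    have "(q ^ 4) ^ 5 = q ^ 20"
      by (simp flip: power_mult)
    then have "qpoch_inf (q ^ 2) (q ^ 4) = (\<Prod>i<5. qpoch_inf (q ^ 2 * (q ^ 4) ^ i) (q ^ 20))"
      using qpoch_inf_dissect[of "q ^ 4" 5 "q ^ 2"] qk by simp
    then show ?thesis
      by (simp only: power_add power_mult)
  qed
  also have "\<dots> = qpoch_inf (q ^ 2) (q ^ 20) * qpoch_inf (q ^ 6) (q ^ 20) * qpoch_inf (q ^ 10) (q ^ 20)
      * qpoch_inf (q ^ 14) (q ^ 20) * qpoch_inf (q ^ 18) (q ^ 20)"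
    by (simp add: eval_nat_numeral)
  finally have 5: "qpoch_inf (q ^ 2) (q ^ 4) = qpoch_inf (q ^ 2) (q ^ 20) * qpoch_inf (q ^ 6) (q ^ 20)
      * qpoch_inf (q ^ 10) (q ^ 20) * qpoch_inf (q ^ 14) (q ^ 20) * qpoch_inf (q ^ 18) (q ^ 20)" .
  have 10: "qpoch_inf (q ^ k) (q ^ 10) = qpoch_inf (q ^ k) (q ^ 20) * qpoch_inf (q ^ (k + 10)) (q ^ 20)" for k
  proof -
    have "(q ^ 10) ^ 2 = q ^ 20" "{..<2} = {0, 1::nat}"
      by (auto simp flip: power_mult)
    then show ?thesis
      using qpoch_inf_dissect[of "q ^ 10" 2 "q ^ k"] qk by (simp add: power_add)
  qed
  show ?thesis
    unfolding Z 5 qpochs_inf_def using 10[of 4] 10[of 6] 10[of 10] by simp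
qed

section \<open>The recurrences in \<open>m\<close>\<close>

lemma summable_slater_series:
  assumes "norm q < 1"
  shows "summable (\<lambda>n. q ^ (n ^ 2 + 2 * m * n) / qpoch q q (k n))"
proof -
  obtain C where C: "\<And>n. norm (inverse (qpoch q q n)) \<le> C"
    using qpoch_inverse_bounded[OF assms self_mult_power_neq_one[OF assms]] by metis
  show ?thesis
  proof (rule summable_comparison_test)
    show "summable (\<lambda>n. norm q ^ (n ^ 2) * C)"
      by (intro summable_mult2 summable_norm_square_power assms)
    have "norm (q ^ (n ^ 2 + 2 * m * n) / qpoch q q (k n)) \<le> norm q ^ (n ^ 2) * C" for n
      unfolding divide_inverse norm_mult norm_power
      using assms C by (intro mult_mono power_decreasing) auto
    then show "\<exists>N. \<forall>n\<ge>N. norm (q ^ (n ^ 2 + 2 * m * n) / qpoch q q (k n)) \<le> norm q ^ (n ^ 2) * C"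
      by blast
  qed
qed

definition odd_series :: "complex \<Rightarrow> nat \<Rightarrow> complex" where
  "odd_series q m = (\<Sum>n. q ^ (n ^ 2 + 2 * m * n) / qpoch q q (2 * n + 1))"

definition even_series :: "complex \<Rightarrow> nat \<Rightarrow> complex" where
  "even_series q m = (\<Sum>n. q ^ (n ^ 2 + 2 * m * n) / qpoch q q (2 * n))"

lemma odd_series_sums:
  "norm q < 1 \<Longrightarrow> (\<lambda>n. q ^ (n ^ 2 + 2 * m * n) / qpoch q q (2 * n + 1)) sums odd_series q m"
  unfolding odd_series_def by (intro summable_sums summable_slater_series)

lemma even_series_sums:
  "norm q < 1 \<Longrightarrow> (\<lambda>n. q ^ (n ^ 2 + 2 * m * n) / qpoch q q (2 * n)) sums even_series q m"
  unfolding even_series_def by (intro summable_sums summable_slater_series)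

text \<open>Termwise the difference produces 1 - q^(2n+1), the last factor of the
  denominator.\<close>

lemma odd_series_diff:
  assumes q: "norm q < 1"
  shows "odd_series q m - q * odd_series q (Suc m) = even_series q m"
proof -
  have "q ^ (n ^ 2 + 2 * m * n) / qpoch q q (2 * n + 1) - q * (q ^ (n ^ 2 + 2 * Suc m * n) / qpoch q q (2 * n + 1))
      = q ^ (n ^ 2 + 2 * m * n) / qpoch q q (2 * n)" for n
  proof -
    have "q * q ^ (n ^ 2 + 2 * Suc m * n) = q ^ (n ^ 2 + 2 * m * n) * (q * q ^ (2 * n))"
      by (simp add: algebra_simps power_add)
    then have "q ^ (n ^ 2 + 2 * m * n) / qpoch q q (2 * n + 1) - q * (q ^ (n ^ 2 + 2 * Suc m * n) / qpoch q q (2 * n + 1))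
        = q ^ (n ^ 2 + 2 * m * n) * (1 - q * q ^ (2 * n)) / qpoch q q (2 * n + 1)"
      by (simp add: right_diff_distrib diff_divide_distrib)
    then show ?thesis
      using self_mult_power_neq_one[OF q, of "2 * n"] by (simp add: qpoch_Suc)
  qed
  then show ?thesis
    using sums_diff[OF odd_series_sums[OF q, of m] sums_mult[OF odd_series_sums[OF q, of "Suc m"], of q]]
      even_series_sums[OF q, of m] sums_unique2 by simp
qed

text \<open>Termwise the difference produces 1 - q^(2n), which removes the term \<open>n = 0\<close>
  and cancels the last factor of the other denominators. Reindexing by one then releases the power
  q^(2m+1).\<close>

lemma even_series_diff:
  assumes q: "norm q < 1"
  shows "even_series q m - even_series q (Suc m) = q ^ (2 * m + 1) * odd_series q (Suc m)"
proof -
  define f where "f n = q ^ (n ^ 2 + 2 * m * n) / qpoch q q (2 * n) - q ^ (n ^ 2 + 2 * Suc m * n) / qpoch q q (2 * n)" for n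
  have "f (Suc n) = q ^ (2 * m + 1) * (q ^ (n ^ 2 + 2 * Suc m * n) / qpoch q q (2 * n + 1))" for n
  proof -
    have "(Suc n) ^ 2 + 2 * m * Suc n = (2 * m + 1) + (n ^ 2 + 2 * Suc m * n)"
      "(Suc n) ^ 2 + 2 * Suc m * Suc n = (2 * m + 1) + (n ^ 2 + 2 * Suc m * n) + Suc (2 * n + 1)"
      by (simp_all add: power2_eq_square algebra_simps)
    then have "f (Suc n) = q ^ (2 * m + 1) * q ^ (n ^ 2 + 2 * Suc m * n) * (1 - q * q ^ (2 * n + 1)) / qpoch q q (2 * Suc n)"
      by (simp only: f_def power_add power_Suc[of q "2 * n + 1"] right_diff_distrib diff_divide_distrib mult_1_right)
    moreover have "qpoch q q (2 * Suc n) = qpoch q q (2 * n + 1) * (1 - q * q ^ (2 * n + 1))"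
      by (simp add: qpoch_Suc)
    moreover have "1 - q * q ^ (2 * n + 1) \<noteq> 0"
      using self_mult_power_neq_one[OF q, of "2 * n + 1"] by simp
    ultimately show ?thesis by (simp del: power_Suc)
  qed
  then have "(\<lambda>n. f (n + 1)) sums (q ^ (2 * m + 1) * odd_series q (Suc m))"
    using sums_mult[OF odd_series_sums[OF q, of "Suc m"], of "q ^ (2 * m + 1)"] by simp
  then have "f sums (q ^ (2 * m + 1) * odd_series q (Suc m))"
    unfolding sums_iff_shift by (simp add: f_def)
  moreover have "f sums (even_series q m - even_series q (Suc m))"
    unfolding f_def by (intro sums_diff even_series_sums q)
  ultimately show ?thesis
    using sums_unique2 by blast
qed

text \<open>Elimination of the even series from the two difference relations.\<close>

lemma odd_series_rec:
  assumes q: "norm q < 1"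
  shows "q * odd_series q (m + 2) = (1 + q + q ^ (2 * m + 1)) * odd_series q (m + 1) - odd_series q m"
proof -
  define a where "a = odd_series q m"
  define b where "b = odd_series q (m + 1)"
  define c where "c = odd_series q (m + 2)"
  define w where "w = q ^ (2 * m + 1)"
  have "(a - q * b) - (b - q * c) = w * b"
    using odd_series_diff[OF q, of m] odd_series_diff[OF q, of "m + 1"] even_series_diff[OF q, of m]
    by (simp add: a_def b_def c_def w_def)
  then show ?thesis
    unfolding a_def[symmetric] b_def[symmetric] c_def[symmetric] w_def[symmetric]
    by (simp add: algebra_simps)
qed

text \<open>Elimination in the other direction: all three even values are expressed through the odd
  series at \<open>m + 1\<close> and \<open>m + 2\<close>.\<close>

lemma even_series_rec:
  assumes q: "norm q < 1"
  shows "even_series q (m + 2) = (1 + q + q ^ (2 * m + 2)) * even_series q (m + 1) - q * even_series q m"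
proof -
  define s where "s = odd_series q (m + 1)"
  define s' where "s' = odd_series q (m + 2)"
  define w where "w = q ^ (2 * m + 1)"
  have 1: "even_series q (m + 1) = s - q * s'"
    using odd_series_diff[OF q, of "m + 1"] by (simp add: s_def s'_def)
  have 2: "even_series q m = even_series q (m + 1) + w * s"
    using even_series_diff[OF q, of m] by (simp add: s_def w_def algebra_simps)
  have 3: "even_series q (m + 2) = even_series q (m + 1) - w * q ^ 2 * s'"
    using even_series_diff[OF q, of "m + 1"] by (simp add: s'_def w_def power2_eq_square algebra_simps)
  have 4: "q ^ (2 * m + 2) = w * q"
    by (simp add: w_def)
  show ?thesis
    unfolding 4 3 2 1 by (simp add: algebra_simps power2_eq_square)
qed

section \<open>Initial values and induction on m\<close>

theorem theorem2p6:
  fixes q :: complex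
    and P Q :: "int \<Rightarrow> complex"
    and A B :: "nat \<Rightarrow> complex"
  assumes q: "0 < norm q" "norm q < 1"
    and P_rec: "\<And>m. m \<ge> 2 \<Longrightarrow> P m = (1 + q + q powi (2 * m - 1)) * P (m - 1) - q * P (m - 2)"
    and P_init: "P (-1) = 1" "P 0 = 1" "P 1 = 1 + q"
    and Q_rec: "\<And>m. m \<ge> 2 \<Longrightarrow> Q m = (1 + q + q powi (2 * m - 1)) * Q (m - 1) - q * Q (m - 2)"
    and Q_init: "Q (-1) = - inverse q" "Q 0 = 0" "Q 1 = 1"
    and A_rec: "\<And>m. m \<ge> 2 \<Longrightarrow> A m = (1 + q + q ^ (2 * m - 2)) * A (m - 1) - q * A (m - 2)"
    and A_init: "A 0 = 1" "A 1 = 1"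
    and B_rec: "\<And>m. m \<ge> 2 \<Longrightarrow> B m = (1 + q + q ^ (2 * m - 2)) * B (m - 1) - q * B (m - 2)"
    and B_init: "B 0 = 0" "B 1 = q"
  shows "(\<forall>m::nat.
      (\<lambda>n::nat. q ^ (n^2 + 2 * m * n) / qpoch q q (2 * n + 1)) sums
        (q powi (1 - int m) * qpochs_inf [q^4, q^6, q^10] (q^10) * qpochs_inf [q^2, q^18] (q^20)
            / qpoch_inf q q * P (int m - 1)
         - q powi (1 - int m) * qpochs_inf [q^8, q^12, q^20] (q^20) * qpoch_inf (- q) (q^2)
            / qpoch_inf (q^2) (q^2) * Q (int m - 1)))
    \<and> (\<forall>m::nat.
      (\<lambda>n::nat. q ^ (n^2 + 2 * m * n) / qpoch q q (2 * n)) sums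
        (qpochs_inf [q^8, q^12, q^20] (q^20) * qpoch_inf (- q) (q^2)
            / qpoch_inf (q^2) (q^2) * A m
         - qpochs_inf [q^4, q^6, q^10] (q^10) * qpochs_inf [q^2, q^18] (q^20)
            / qpoch_inf q q * B m))"
proof -
  define X where "X = qpochs_inf [q^4, q^6, q^10] (q^10) * qpochs_inf [q^2, q^18] (q^20) / qpoch_inf q q"
  define Y where "Y = qpochs_inf [q^8, q^12, q^20] (q^20) * qpoch_inf (- q) (q^2) / qpoch_inf (q^2) (q^2)"
  have q0: "q \<noteq> 0" using q by auto
  note q1 = q(2)
  have "even_series q 0 = Y"
    by (rule sums_unique2[OF even_series_sums[OF q1]])
       (use slater_mod_twenty(1)[OF q1 q0] in \<open>simp add: Y_def\<close>)
  have "odd_series q 0 = (qpochs_inf [q ^ 8, q ^ 12, q ^ 20] (q ^ 20) + q * qpochs_inf [q ^ 4, q ^ 16, q ^ 20] (q ^ 20)) *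
      (qpoch_inf (- q) (q ^ 2) / qpoch_inf (q ^ 2) (q ^ 2))"
    by (rule sums_unique2[OF odd_series_sums[OF q1]])
       (use slater_mod_twenty(2)[OF q1 q0] in \<open>simp only: mult_0_right mult_0 add_0_right\<close>)
  then have "odd_series q 0 = Y + q * X"
    unfolding Y_def X_def slater_product[OF q1 q0, symmetric] by (simp only: distrib_right mult.assoc times_divide_eq_right add_divide_distrib)
  \<comment> \<open>The relation at m = 0 reads Y + qX - q S_1 = Y, and \<open>q\<close> is
    nonzero.\<close>
  with \<open>even_series q 0 = Y\<close> have "odd_series q 1 = X"
    using odd_series_diff[OF q1, of 0] q0 by (simp add: algebra_simps)
  have "even_series q 1 = Y - q * X"
    using even_series_diff[OF q1, of 0] \<open>even_series q 0 = Y\<close> \<open>odd_series q 1 = X\<close>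
    by (simp add: algebra_simps)
  have even: "even_series q m = Y * A m - X * B m" for m
  proof (induction m rule: induct_nat_012)
    case (ge2 m)
    define w where "w = q ^ (2 * m + 2)"
    have rec: "A (Suc (Suc m)) = (1 + q + w) * A (Suc m) - q * A m"
      "B (Suc (Suc m)) = (1 + q + w) * B (Suc m) - q * B m"
      using A_rec[of "Suc (Suc m)"] B_rec[of "Suc (Suc m)"] by (simp_all add: w_def)
    have "even_series q (Suc (Suc m)) = (1 + q + w) * even_series q (Suc m) - q * even_series q m"
      using even_series_rec[OF q1, of m] by (simp add: w_def)
    then show ?case
      unfolding rec ge2 by (simp add: algebra_simps)
  qed (use A_init B_init \<open>even_series q 0 = Y\<close> \<open>even_series q 1 = Y - q * X\<close> in simp_all)
  \<comment> \<open>The prefactor q^(1-m) is cleared because q^m times the odd series satisfies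
    exactly the recurrence of \<open>P\<close> and \<open>Q\<close>, with the index moved by
    one.\<close>
  have odd: "q ^ m * odd_series q m = q * (X * P (int m - 1) - Y * Q (int m - 1))" for m
  proof (induction m rule: induct_nat_012)
    case (ge2 m)
    define w where "w = q ^ (2 * m + 1)"
    have rec: "P (int m + 1) = (1 + q + w) * P (int m) - q * P (int m - 1)"
      "Q (int m + 1) = (1 + q + w) * Q (int m) - q * Q (int m - 1)"
    proof -
      have "q powi (2 * (int m + 1) - 1) = w"
        unfolding w_def power_int_of_nat[symmetric] by simp
      \<comment> \<open>For \<open>m = 0\<close> this is the recurrence at index 1, outside the
        range of \<open>P_rec\<close> and \<open>Q_rec\<close>; the prescribed values at -1, 0 and 1
        satisfy it.\<close>
      then have "P (int m + 1) = (1 + q + w) * P (int m) - q * P (int m - 1) \<and>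
          Q (int m + 1) = (1 + q + w) * Q (int m) - q * Q (int m - 1)"
        using P_rec[of "int m + 1"] Q_rec[of "int m + 1"] P_init Q_init q0 by (cases "m = 0") auto
      then show "P (int m + 1) = (1 + q + w) * P (int m) - q * P (int m - 1)"
        "Q (int m + 1) = (1 + q + w) * Q (int m) - q * Q (int m - 1)" by auto
    qed
    have "q ^ Suc (Suc m) * odd_series q (Suc (Suc m)) = q ^ Suc m * (q * odd_series q (m + 2))"
      by simp
    also have "\<dots> = (1 + q + w) * (q ^ Suc m * odd_series q (Suc m)) - q * (q ^ m * odd_series q m)"
      unfolding odd_series_rec[OF q1] w_def[symmetric] by (simp add: algebra_simps)
    also have "\<dots> = q * (X * P (int m + 1) - Y * Q (int m + 1))"
      unfolding ge2 rec by (simp add: algebra_simps)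
    finally show ?case by (simp add: add.commute)
  qed (use P_init Q_init q0 \<open>odd_series q 0 = Y + q * X\<close> \<open>odd_series q 1 = X\<close> in \<open>simp_all add: algebra_simps\<close>)
  have odd': "odd_series q m = q powi (1 - int m) * X * P (int m - 1) - q powi (1 - int m) * Y * Q (int m - 1)" for m
    using odd[of m] q0 by (simp add: power_int_diff field_simps)
  show ?thesis
  proof (intro conjI allI)
    fix m :: nat
    show "(\<lambda>n. q ^ (n^2 + 2 * m * n) / qpoch q q (2 * n + 1)) sums
        (q powi (1 - int m) * qpochs_inf [q^4, q^6, q^10] (q^10) * qpochs_inf [q^2, q^18] (q^20)
            / qpoch_inf q q * P (int m - 1)
         - q powi (1 - int m) * qpochs_inf [q^8, q^12, q^20] (q^20) * qpoch_inf (- q) (q^2)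
            / qpoch_inf (q^2) (q^2) * Q (int m - 1))"
      using odd_series_sums[OF q1, of m] unfolding odd' X_def Y_def
      by (simp only: mult.assoc times_divide_eq_right)
    show "(\<lambda>n. q ^ (n^2 + 2 * m * n) / qpoch q q (2 * n)) sums
        (qpochs_inf [q^8, q^12, q^20] (q^20) * qpoch_inf (- q) (q^2)
            / qpoch_inf (q^2) (q^2) * A m
         - qpochs_inf [q^4, q^6, q^10] (q^10) * qpochs_inf [q^2, q^18] (q^20)
            / qpoch_inf q q * B m)"
      using even_series_sums[OF q1, of m] unfolding even X_def Y_def .
  qed
qed

end
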